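(* Let $G$ be a finite group. If $\mathrm{pr}^*_G(2',2')>7/15$, then $G$ is soluble.
   Context: For subsets $X,Y$ of a finite group $G$, $\Pr(X,Y)=|\{(x,y)\in X\times Y: xy=yx\}|/(|X||Y|)$. For sets of primes $\pi_1,\pi_2$, $\mathrm{pr}^*_G(\pi_1,\pi_2)$ denotes the maximum real number $\epsilon$ such that for every pair of distinct primes $p\in\pi_1$, $q\in\pi_2$ there exist a Sylow $p$-subgroup $P$ and a Sylow $q$-subgroup $Q$ of $G$ with $\Pr(P,Q)\ge\epsilon$ (the Sylow $p$-subgroup is taken to be trivial if $p\nmid|G|$). For a prime $r$, $r'$ denotes the set of all primes different from $r$; so $2'$ is the set of odd primes. *)

theory Defs
  imports "HOL-Algebra.Algebra" "HOL-Computational_Algebra.Primes"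
begin

definition comm_prob :: "('a, 'b) monoid_scheme \<Rightarrow> 'a set \<Rightarrow> 'a set \<Rightarrow> real" where
  "comm_prob G A B =
     real (card {(x, y). x \<in> A \<and> y \<in> B \<and> x \<otimes>\<^bsub>G\<^esub> y = y \<otimes>\<^bsub>G\<^esub> x})
     / (real (card A) * real (card B))"

text \<open>Sylow p-subgroup: a subgroup of order the full p-part of |G|
  (trivial when p does not divide |G|).\<close>
definition sylow_subgroup :: "('a, 'b) monoid_scheme \<Rightarrow> nat \<Rightarrow> 'a set \<Rightarrow> bool" where
  "sylow_subgroup G p P \<longleftrightarrow> subgroup P G \<and> card P = p ^ multiplicity p (order G)"

definition pr_star :: "('a, 'b) monoid_scheme \<Rightarrow> nat set \<Rightarrow> nat set \<Rightarrow> real" where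
  "pr_star G \<pi>1 \<pi>2 = (GREATEST \<epsilon>. \<forall>p\<in>\<pi>1. \<forall>q\<in>\<pi>2. p \<noteq> q \<longrightarrow>
      (\<exists>P Q. sylow_subgroup G p P \<and> sylow_subgroup G q Q \<and> comm_prob G P Q \<ge> \<epsilon>))"

definition primes_except :: "nat \<Rightarrow> nat set" where
  "primes_except r = {p. Factorial_Ring.prime p \<and> p \<noteq> r}"

end

theory Submission
  imports Defs "Jordan_Normal_Form.Schur_Decomposition"
begin

text \<open>
  If Sylow subgroups \<open>P\<close>, \<open>Q\<close> for distinct odd primes \<open>p\<close>, \<open>q\<close> do not centralise each other,
  then \<open>Pr(P,Q) \<le> 1 - (1 - 1/p)(1 - 1/q) \<le> 7/15\<close>. So under the hypothesis some Sylow \<open>p\<close>- and some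
  Sylow \<open>q\<close>-subgroup commute, for all odd \<open>p \<noteq> q\<close>; this property passes to normal subgroups and
  quotients, and it remains to exclude non-abelian simple groups. There a central element \<open>g\<close> of a
  Sylow subgroup for an odd prime (or any \<open>g\<close>, if the group is a 2-group) has a conjugacy class \<open>K\<close> of 2-power size, which contradicts
  Burnside's theorem on classes of prime power size.

  Burnside's theorem is proved without representations. Let \<open>q = |K| = p^a > 1\<close> for a prime \<open>p\<close> and let \<open>M\<close> be the
  operator of multiplication by the class sum of \<open>K\<close> on the functions of sum zero on \<open>G\<close>.
  It has trace \<open>-q\<close>. The map \<open>N: x \<mapsto> g x g\<close> has finite order and commutes with \<open>M\<close>, and
  averaging over conjugates gives \<open>tr (N M^k) = tr (M^(k+2)) / q^2\<close>. Comparing these power sums,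
  \<open>d \<alpha>^2\<close> is an algebraic integer for every eigenvalue \<open>q \<alpha>\<close> of \<open>M\<close> of multiplicity \<open>d\<close>.
  If \<open>p\<close> does not divide \<open>d\<close>, then \<open>\<alpha>\<close> itself is an algebraic integer all of whose conjugates have
  absolute value at most 1, so \<open>\<alpha> = 0\<close> or \<open>|\<alpha>| = 1\<close>; the latter is impossible in a simple group by
  the maximum principle. Hence \<open>(d \<alpha>)^2\<close> is divisible by \<open>p\<close> for all nonzero \<open>\<alpha>\<close>, and
  \<open>-1 = \<Sum> d \<alpha>\<close> would lie in the radical of \<open>p\<close> in the ring of algebraic integers.
\<close>

section \<open>Algebraic integers\<close>

text \<open>The vector \<open>v\<close> exhibits \<open>x\<close> as an eigenvalue of the integer
  matrix \<open>B\<close>, hence as a root of a characteristic polynomial that is monic with integer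
  coefficients.\<close>

lemma algebraic_int_of_int_system:
  fixes x :: complex and v :: "'i \<Rightarrow> complex"
  assumes fin: "finite I" and i0: "i0 \<in> I" "v i0 \<noteq> 0"
    and sys: "\<And>i. i \<in> I \<Longrightarrow> x * v i = (\<Sum>j\<in>I. of_int (B i j) * v j)"
  shows "algebraic_int x"
proof -
  define n where "n = card I"
  obtain b where b: "bij_betw b {0..<n} I"
    using ex_bij_betw_nat_finite[OF fin] unfolding n_def by blast
  define A where "A = mat n n (\<lambda>(i,j). B (b i) (b j))"
  define w where "w = vec n (\<lambda>i. v (b i))"
  have A: "A \<in> carrier_mat n n" by (simp add: A_def)
  let ?A = "map_mat of_int A :: complex mat"
  have Ac: "?A \<in> carrier_mat n n" using A by simp
  have bI: "b i \<in> I" if "i < n" for i using b that by (auto simp: bij_betw_def)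
  obtain k where k: "k < n" "b k = i0"
    using b i0(1) by (auto simp: bij_betw_def)
  have "eigenvector ?A w x"
    unfolding eigenvector_def
  proof (intro conjI)
    show "w \<in> carrier_vec (dim_row ?A)" by (simp add: w_def A_def)
    have "w $ k \<noteq> 0" using k i0 by (simp add: w_def)
    thus "w \<noteq> 0\<^sub>v (dim_row ?A)" using k by (auto simp: A_def)
    show "?A *\<^sub>v w = x \<cdot>\<^sub>v w"
    proof (rule eq_vecI)
      fix i assume "i < dim_vec (x \<cdot>\<^sub>v w)"
      hence i: "i < n" by (simp add: w_def)
      have "(?A *\<^sub>v w) $ i = (\<Sum>j\<in>{0..<n}. of_int (B (b i) (b j)) * v (b j))"
        using i by (simp add: A_def w_def scalar_prod_def)
      also have "\<dots> = (\<Sum>j\<in>I. of_int (B (b i) j) * v j)"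
        by (rule sum.reindex_bij_betw[OF b])
      also have "\<dots> = x * v (b i)" using sys[OF bI[OF i]] by simp
      finally show "(?A *\<^sub>v w) $ i = (x \<cdot>\<^sub>v w) $ i" using i by (simp add: w_def)
    qed (simp add: A_def w_def)
  qed
  hence "eigenvalue ?A x" unfolding eigenvalue_def by blast
  hence "poly (char_poly ?A) x = 0" using eigenvalue_root_char_poly[OF Ac] by simp
  hence "poly (map_poly of_int (char_poly A)) x = 0"
    by (simp add: of_int_hom.char_poly_hom[OF A])
  moreover have "lead_coeff (char_poly A) = 1" using degree_monic_char_poly[OF A] by simp
  ultimately show ?thesis unfolding algebraic_int_altdef_ipoly by blast
qed

text \<open>The converse direction: the companion matrix of a monic integer polynomial with root
  \<open>x\<close> acts on the vector of powers of \<open>x\<close>.\<close>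

lemma algebraic_int_imp_int_system:
  fixes x :: complex
  assumes "algebraic_int x"
  obtains n :: nat and B where "n > 0"
    "\<And>i. i < n \<Longrightarrow> x * x ^ i = (\<Sum>j<n. of_int (B i j) * x ^ j)"
proof -
  obtain p where p: "poly (map_poly of_int p) x = 0" "lead_coeff p = 1"
    using assms unfolding algebraic_int_altdef_ipoly by blast
  define n where "n = degree p"
  have "n > 0"
  proof (rule ccontr)
    assume "\<not> n > 0"
    then obtain c where "p = [:c:]" unfolding n_def by (auto elim: degree_eq_zeroE)
    thus False using p by auto
  qed
  \<comment> \<open>Each row but the last shifts the exponent by one; the last row rewrites
    \<open>x ^ n\<close> by the monic equation.\<close>
  define B where "B = (\<lambda>i j. if i = n - 1 then - coeff p j else if j = Suc i then 1 else 0)"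
  have "x * x ^ i = (\<Sum>j<n. of_int (B i j) * x ^ j)" if i: "i < n" for i
  proof (cases "i = n - 1")
    case True
    have "0 = (\<Sum>j\<le>n. of_int (coeff p j) * x ^ j)"
      using p(1) by (simp add: poly_altdef degree_map_poly coeff_map_poly n_def)
    also have "\<dots> = (\<Sum>j<n. of_int (coeff p j) * x ^ j) + x ^ n"
      using p(2) by (simp add: n_def lessThan_Suc_atMost[symmetric])
    finally have "x ^ n = - (\<Sum>j<n. of_int (coeff p j) * x ^ j)"
      by (simp add: eq_neg_iff_add_eq_0 add.commute)
    moreover have "x * x ^ i = x ^ n" using True \<open>n > 0\<close> by (cases n) auto
    ultimately show ?thesis using True by (simp add: B_def sum_negf)
  next
    case False
    hence "Suc i < n" using i by simp
    have "(\<Sum>j<n. of_int (B i j) * x ^ j) = (\<Sum>j<n. if j = Suc i then x ^ j else 0)"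
      using False by (intro sum.cong) (auto simp: B_def)
    also have "\<dots> = x ^ Suc i" using \<open>Suc i < n\<close> by simp
    finally show ?thesis by simp
  qed
  with \<open>n > 0\<close> show ?thesis using that by blast
qed

text \<open>With \<open>x\<close> and \<open>y\<close> as eigenvalues of \<open>B\<close> and
  \<open>C\<close>, the products \<open>x ^ i * y ^ j\<close> form an eigenvector of the Kronecker
  product of the two matrices for \<open>x * y\<close>, and of their Kronecker sum for
  \<open>x + y\<close>.\<close>

lemma
  fixes x y :: complex
  assumes "algebraic_int x" "algebraic_int y"
  shows algebraic_int_add: "algebraic_int (x + y)"
    and algebraic_int_mult: "algebraic_int (x * y)"
proof -
  obtain n B where n: "n > 0" and
    B: "\<And>i. i < n \<Longrightarrow> x * x ^ i = (\<Sum>j<n. of_int (B i j) * x ^ j)"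
    using algebraic_int_imp_int_system[OF assms(1)] by metis
  obtain m C where m: "m > 0" and
    C: "\<And>i. i < m \<Longrightarrow> y * y ^ i = (\<Sum>j<m. of_int (C i j) * y ^ j)"
    using algebraic_int_imp_int_system[OF assms(2)] by metis
  let ?I = "{..<n} \<times> {..<m}" and ?v = "\<lambda>(i,j). x ^ i * y ^ j"
  show "algebraic_int (x * y)"
  proof (rule algebraic_int_of_int_system[of ?I "(0,0)" ?v _ "\<lambda>(i,j) (k,l). B i k * C j l"])
    fix ij assume "ij \<in> ?I"
    then obtain i j where ij: "ij = (i,j)" "i < n" "j < m" by auto
    have "x * y * ?v ij = (x * x ^ i) * (y * y ^ j)" by (simp add: ij)
    also have "\<dots> = (\<Sum>k<n. \<Sum>l<m. of_int (B i k * C j l) * (x ^ k * y ^ l))"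
      unfolding B[OF ij(2)] C[OF ij(3)] sum_product by (intro sum.cong) auto
    finally show "x * y * ?v ij = (\<Sum>kl\<in>?I. of_int ((\<lambda>(i,j) (k,l). B i k * C j l) ij kl) * ?v kl)"
      by (simp add: ij sum.cartesian_product case_prod_unfold)
  qed (use n m in auto)
  show "algebraic_int (x + y)"
  proof (rule algebraic_int_of_int_system[of ?I "(0,0)" ?v _
        "\<lambda>(i,j) (k,l). (if j = l then B i k else 0) + (if i = k then C j l else 0)"])
    fix ij assume "ij \<in> ?I"
    then obtain i j where ij: "ij = (i,j)" "i < n" "j < m" by auto
    have "(x + y) * ?v ij = (x * x ^ i) * y ^ j + x ^ i * (y * y ^ j)"
      by (simp add: ij algebra_simps)
    also have "(x * x ^ i) * y ^ j = (\<Sum>k<n. of_int (B i k) * (x ^ k * y ^ j))"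
      unfolding B[OF ij(2)] sum_distrib_right by (intro sum.cong) auto
    also have "\<dots> = (\<Sum>k<n. \<Sum>l<m. of_int (if j = l then B i k else 0) * (x ^ k * y ^ l))"
      using ij by (intro sum.cong) (auto simp: if_distrib if_distribR cong: if_cong)
    also have "x ^ i * (y * y ^ j) = (\<Sum>l<m. of_int (C j l) * (x ^ i * y ^ l))"
      unfolding C[OF ij(3)] sum_distrib_left by (intro sum.cong) auto
    also have "\<dots> = (\<Sum>l<m. \<Sum>k<n. of_int (if i = k then C j l else 0) * (x ^ k * y ^ l))"
      using ij by (intro sum.cong) (auto simp: if_distrib if_distribR cong: if_cong)
    also have "\<dots> = (\<Sum>k<n. \<Sum>l<m. of_int (if i = k then C j l else 0) * (x ^ k * y ^ l))"
      by (rule sum.swap)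
    finally show "(x + y) * ?v ij = (\<Sum>kl\<in>?I. of_int ((\<lambda>(i,j) (k,l).
        (if j = l then B i k else 0) + (if i = k then C j l else 0)) ij kl) * ?v kl)"
      by (simp add: ij sum.cartesian_product case_prod_unfold sum.distrib algebra_simps cong: if_cong)
  qed (use n m in auto)
qed

lemma algebraic_int_sum:
  "(\<And>i. i \<in> I \<Longrightarrow> algebraic_int (f i)) \<Longrightarrow> algebraic_int (\<Sum>i\<in>I. f i :: complex)"
  by (induction I rule: infinite_finite_induct) (auto intro: algebraic_int_add)

lemma algebraic_int_prod_list:
  "(\<And>z. z \<in> set zs \<Longrightarrow> algebraic_int z) \<Longrightarrow> algebraic_int (prod_list zs :: complex)"
  by (induction zs) (auto intro: algebraic_int_mult int_imp_algebraic_int)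

lemma algebraic_int_power: "algebraic_int (x :: complex) \<Longrightarrow> algebraic_int (x ^ n)"
  by (induction n) (auto intro: algebraic_int_mult int_imp_algebraic_int)

lemma algebraic_int_of_power:
  assumes "algebraic_int ((x :: complex) ^ n)" "n > 0"
  shows "algebraic_int x"
  by (rule algebraic_int_root[OF assms(1), of "monom 1 n"])
     (use assms(2) in \<open>auto simp: poly_monom degree_monom_eq\<close>)

section \<open>Conjugates of an algebraic integer\<close>

text \<open>Up to a scalar, \<open>h\<close> is the minimal polynomial of \<open>x\<close>. The
  remainder \<open>c mod h\<close> also vanishes at \<open>x\<close>, so minimality of the degree
  makes it zero and \<open>h\<close> divides \<open>c\<close>.\<close>

lemma root_common_of_minimal:
  fixes x z :: complex and h c :: "rat poly"
  assumes h: "h \<noteq> 0" "poly (map_poly of_rat h) x = 0"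
    and min: "\<And>g. g \<noteq> 0 \<Longrightarrow> poly (map_poly of_rat g) x = 0 \<Longrightarrow> degree h \<le> degree g"
    and c: "poly (map_poly of_rat c) x = 0" and z: "poly (map_poly of_rat h) z = 0"
  shows "poly (map_poly of_rat c) z = 0"
proof -
  interpret of_rat_poly: map_poly_comm_ring_hom "of_rat :: rat \<Rightarrow> complex" ..
  have eval: "poly (map_poly of_rat c) y = poly (map_poly of_rat (c div h)) y * poly (map_poly of_rat h) y
      + poly (map_poly of_rat (c mod h)) y" for y :: complex
  proof -
    have "map_poly of_rat c = (map_poly of_rat (c div h * h + c mod h) :: complex poly)" by simp
    also have "\<dots> = map_poly of_rat (c div h) * map_poly of_rat h + map_poly of_rat (c mod h)"
      by (simp only: of_rat_poly.hom_add of_rat_poly.hom_mult)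
    finally show ?thesis by simp
  qed
  have "poly (map_poly of_rat (c mod h)) x = 0" using eval[of x] h c by simp
  hence "c mod h = 0" using min[of "c mod h"] degree_mod_less[OF h(1), of c] by force
  thus ?thesis using eval[of z] z by simp
qed

text \<open>The product of all conjugates of \<open>x\<close> is a nonzero rational algebraic
  integer, hence an integer of absolute value at least 1. Since no conjugate exceeds 1 in absolute
  value, none can be smaller than 1.\<close>

lemma norm_eq_1_if_conjugates_bounded:
  fixes x :: complex and c :: "rat poly"
  assumes int: "algebraic_int x" and x0: "x \<noteq> 0"
    and c: "poly (map_poly of_rat c) x = 0"
    and bound: "\<And>z :: complex. poly (map_poly of_rat c) z = 0 \<Longrightarrow> norm z \<le> 1"
  shows "norm x = 1"
proof -
  obtain p where p: "poly (map_poly of_int p) x = 0" "lead_coeff p = 1"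
    using int unfolding algebraic_int_altdef_ipoly by blast
  define f :: "rat poly" where "f = map_poly of_int p"
  have f_eq: "map_poly of_rat f = (map_poly of_int p :: complex poly)"
    by (simp add: f_def map_poly_map_poly o_def)
  have f: "f \<noteq> 0" "poly (map_poly of_rat f) x = 0"
    using p f_eq by (auto simp: f_def)
  define Z where "Z = {g :: rat poly. g \<noteq> 0 \<and> poly (map_poly of_rat g) x = 0}"
  have "f \<in> Z" using f by (simp add: Z_def)
  then obtain h where hZ: "h \<in> Z" and hmin: "\<And>g. g \<in> Z \<Longrightarrow> degree h \<le> degree g"
    using ex_has_least_nat[of "\<lambda>g. g \<in> Z" f degree] by blast
  have h: "h \<noteq> 0" "poly (map_poly of_rat h) x = 0" using hZ by (auto simp: Z_def)
  have hm: "degree h \<le> degree g" if "g \<noteq> 0" "poly (map_poly of_rat g) x = 0" for g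
    using hmin[of g] that by (simp add: Z_def)
  let ?h = "map_poly of_rat h :: complex poly"
  \<comment> \<open>A conjugate of \<open>x\<close> is a root of every rational polynomial that
    vanishes at \<open>x\<close>: of \<open>f\<close>, which makes it integral, and of
    \<open>c\<close>, which bounds it.\<close>
  have rootA: "algebraic_int z" and root1: "norm z \<le> 1" if z: "poly ?h z = 0" for z
  proof -
    have "poly (map_poly of_rat f) z = 0" by (rule root_common_of_minimal[OF h hm f(2) z])
    thus "algebraic_int z" unfolding f_eq algebraic_int_altdef_ipoly using p(2) by blast
    show "norm z \<le> 1" by (rule bound, rule root_common_of_minimal[OF h hm c z])
  qed
  \<comment> \<open>A zero constant term would allow division by the variable, which leaves a
    polynomial of smaller degree that still vanishes at the nonzero number \<open>x\<close>.\<close>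
  have h0: "coeff h 0 \<noteq> 0"
  proof
    assume "coeff h 0 = 0"
    then obtain g where g: "h = pCons 0 g" by (cases h) auto
    hence "g \<noteq> 0" using h by auto
    moreover have "poly (map_poly of_rat g) x = 0"
      using h(2) x0 by (simp add: g of_rat_hom.map_poly_pCons_hom)
    ultimately have "degree h \<le> degree g" by (rule hm)
    thus False using g \<open>g \<noteq> 0\<close> by simp
  qed
  obtain zs where zs: "Polynomial.smult (lead_coeff ?h) (\<Prod>a\<leftarrow>zs. [:- a, 1:]) = ?h"
    using fundamental_theorem_algebra_factorized[of ?h] by blast
  have lc: "lead_coeff ?h \<noteq> 0" using h(1) by (simp add: lead_coeff_map_poly_nz)
  have roots: "poly ?h z = 0 \<longleftrightarrow> z \<in> set zs" for z
    by (subst zs[symmetric]) (use lc in \<open>auto simp: poly_prod_list prod_list_zero_iff o_def\<close>)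
  have "of_rat (coeff h 0) = poly ?h 0" by (simp add: poly_0_coeff_0 coeff_map_poly)
  also have "\<dots> = lead_coeff ?h * prod_list (map uminus zs)"
    by (subst zs[symmetric]) (simp add: poly_prod_list o_def)
  finally have "prod_list (map uminus zs) = of_rat (coeff h 0 / lead_coeff h)"
    using lc h(1) by (simp add: of_rat_divide field_simps coeff_map_poly degree_map_poly)
  hence rat: "prod_list (map uminus zs) \<in> \<rat>" and nz: "prod_list (map uminus zs) \<noteq> 0"
    using h0 h(1) by auto
  have "algebraic_int (prod_list (map uminus zs))"
    by (rule algebraic_int_prod_list) (use rootA roots in auto)
  hence "prod_list (map uminus zs) \<in> \<int>" using rat by (rule rational_algebraic_int_is_int)
  then obtain k :: int where k: "prod_list (map uminus zs) = of_int k" by (auto elim: Ints_cases)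
  have "norm (prod_list (map uminus zs)) \<ge> 1" using nz unfolding k by simp
  \<comment> \<open>A product of factors of absolute value at most 1 is bounded by each single
    factor, in particular by the one that belongs to \<open>x\<close>.\<close>
  moreover have "norm (prod_list (map uminus ys)) \<le> norm y" if "y \<in> set ys"
    "\<And>z. z \<in> set ys \<Longrightarrow> norm z \<le> 1" for ys and y :: complex
    using that
  proof (induction ys)
    case (Cons a ys)
    have le1: "norm (prod_list (map uminus ys)) \<le> 1"
      using Cons.prems(2) by (induction ys) (auto simp: norm_mult intro!: mult_le_one)
    show ?case
    proof (cases "y = a")
      case True
      thus ?thesis using le1 by (simp add: norm_mult mult_left_le)
    next
      case False
      hence "norm (prod_list (map uminus ys)) \<le> norm y" using Cons by auto
      moreover have "norm a \<le> 1" using Cons.prems by auto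
      ultimately show ?thesis
        using mult_left_le_one_le[of "norm (prod_list (map uminus ys))" "norm a"]
        by (simp add: norm_mult)
    qed
  qed simp
  ultimately have "norm x \<ge> 1" using roots[of x] h(2) root1 roots by (meson order_trans)
  thus ?thesis using root1[OF h(2)] by simp
qed

text \<open>A Vandermonde argument: by linearity \<open>z ^ k\<close> may be replaced by any
  polynomial without constant term, and one that vanishes on \<open>S\<close> except at
  \<open>s\<close> isolates \<open>c s\<close>.\<close>

lemma power_sums_zero_imp_zero:
  fixes c :: "complex \<Rightarrow> complex"
  assumes fin: "finite S" and nz: "0 \<notin> S" and s: "s \<in> S"
    and sums: "\<And>k. k \<ge> 1 \<Longrightarrow> (\<Sum>z\<in>S. c z * z ^ k) = 0"
  shows "c s = 0"
proof -
  define p where "p = (\<Prod>t\<in>S - {s}. [:- t, 1:])"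
  have pz: "poly p z = 0 \<longleftrightarrow> z \<in> S - {s}" for z
    using fin by (auto simp: p_def poly_prod)
  have "(\<Sum>z\<in>S. c z * (z * poly p z)) = (\<Sum>z\<in>S. \<Sum>i\<le>degree p. coeff p i * (c z * z ^ Suc i))"
    by (intro sum.cong refl) (simp add: poly_altdef sum_distrib_left mult_ac)
  also have "\<dots> = (\<Sum>i\<le>degree p. coeff p i * (\<Sum>z\<in>S. c z * z ^ Suc i))"
    by (subst sum.swap) (simp add: sum_distrib_left)
  also have "\<dots> = 0" using sums[of "Suc _"] by (simp del: power_Suc)
  finally have "(\<Sum>z\<in>S. c z * (z * poly p z)) = 0" .
  also have "(\<Sum>z\<in>S. c z * (z * poly p z)) = (\<Sum>z\<in>S. if z = s then c s * (s * poly p s) else 0)"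
    using pz by (intro sum.cong) auto
  also have "\<dots> = c s * (s * poly p s)" using fin s by simp
  finally show ?thesis using pz[of s] nz s by auto
qed

section \<open>Traces of powers of complex matrices\<close>

definition mtrace :: "complex mat \<Rightarrow> complex" where
  "mtrace A = (\<Sum>i<dim_row A. A $$ (i,i))"

lemma mat_mult_entry:
  assumes "A \<in> carrier_mat n n" "B \<in> carrier_mat n n" "i < n" "j < n"
  shows "(A * B) $$ (i,j) = (\<Sum>k<n. A $$ (i,k) * B $$ (k,j))"
  using assms by (auto simp: scalar_prod_def atLeast0LessThan)

lemma mtrace_mult_commute:
  assumes "A \<in> carrier_mat n n" "B \<in> carrier_mat n n"
  shows "mtrace (A * B) = mtrace (B * A)"
proof -
  have "mtrace (A * B) = (\<Sum>i<n. \<Sum>k<n. A $$ (i,k) * B $$ (k,i))"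
    unfolding mtrace_def using assms by (auto intro!: sum.cong simp: mat_mult_entry[OF assms] simp del: index_mult_mat(1))
  also have "\<dots> = (\<Sum>k<n. \<Sum>i<n. B $$ (k,i) * A $$ (i,k))"
    by (subst sum.swap) (simp add: mult.commute)
  also have "\<dots> = mtrace (B * A)"
    unfolding mtrace_def using assms by (auto intro!: sum.cong simp: mat_mult_entry[OF assms(2,1)] simp del: index_mult_mat(1))
  finally show ?thesis .
qed

lemma upper_triangular_mult_diag:
  assumes A: "A \<in> carrier_mat n n" "upper_triangular A" and B: "B \<in> carrier_mat n n" "upper_triangular B"
    and ij: "j \<le> i" "i < n"
  shows "(A * B) $$ (i,j) = (if i = j then A $$ (i,i) * B $$ (i,i) else (0 :: complex))"
proof -
  have "A $$ (i,k) * B $$ (k,j) = (if k = i \<and> i = j then A $$ (i,i) * B $$ (i,i) else 0)" if "k < n" for k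
    using upper_triangularD[OF A(2), of k i] upper_triangularD[OF B(2), of j k] A(1) B(1) ij that
    by (cases k i rule: linorder_cases) auto
  hence "(A * B) $$ (i,j) = (\<Sum>k<n. if k = i \<and> i = j then A $$ (i,i) * B $$ (i,i) else 0)"
    using ij by (subst mat_mult_entry[OF A(1) B(1)]) auto
  thus ?thesis using ij by (cases "i = j") auto
qed

lemma upper_triangular_pow_diag:
  assumes A: "A \<in> carrier_mat n n" "upper_triangular (A :: complex mat)"
  shows "upper_triangular (A ^\<^sub>m k) \<and> (\<forall>i<n. (A ^\<^sub>m k) $$ (i,i) = (A $$ (i,i)) ^ k)"
proof (induction k)
  case 0
  thus ?case using A(1) by auto
next
  case (Suc k)
  have C: "A ^\<^sub>m k \<in> carrier_mat n n" using A(1) by simp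
  note * = upper_triangular_mult_diag[OF C conjunct1[OF Suc] A]
  show ?case
  proof (intro conjI allI impI)
    show "upper_triangular (A ^\<^sub>m Suc k)"
    proof (rule upper_triangularI)
      fix j i assume "j < i" "i < dim_row (A ^\<^sub>m Suc k)"
      thus "(A ^\<^sub>m Suc k) $$ (i,j) = 0" using *[of j i] A(1) by simp
    qed
    fix i assume "i < n"
    thus "(A ^\<^sub>m Suc k) $$ (i,i) = (A $$ (i,i)) ^ Suc k" using *[of i i] Suc by simp
  qed
qed

text \<open>Schur triangularisation reduces this to the diagonal of an upper triangular matrix. One
  list serves for the roots of the characteristic polynomial and for all power sums, which ties
  multiplicities of eigenvalues to traces.\<close>

lemma mtrace_pow_eq_power_sum:
  assumes A: "A \<in> carrier_mat n n"
  obtains es where "char_poly A = (\<Prod>a\<leftarrow>es. [:- a, 1:])"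
    "\<And>k. mtrace (A ^\<^sub>m k) = (\<Sum>e\<leftarrow>es. e ^ k)"
proof -
  obtain as where as: "char_poly A = (\<Prod>a\<leftarrow>as. [:- a, 1:])"
    using char_poly_factorized[OF A] by blast
  obtain B where B: "B \<in> carrier_mat n n" "upper_triangular B" and sim: "similar_mat A B"
    using schur_decomposition_exists[OF A as] by blast
  obtain P Q where PQ: "similar_mat_wit A B P Q" using sim unfolding similar_mat_def by blast
  note w = similar_mat_witD2[OF A PQ]
  have "char_poly A = (\<Prod>a\<leftarrow>diag_mat B. [:- a, 1:])"
    using char_poly_similar[OF sim] char_poly_upper_triangular[OF B] by simp
  moreover have "mtrace (A ^\<^sub>m k) = (\<Sum>e\<leftarrow>diag_mat B. e ^ k)" for k
  proof -
    have Bk: "B ^\<^sub>m k \<in> carrier_mat n n" using B by simp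
    have "mtrace (A ^\<^sub>m k) = mtrace (P * (B ^\<^sub>m k * Q))"
      using similar_mat_wit_pow_id[OF PQ, of k] w Bk by (simp add: assoc_mult_mat[of P n n _ n Q n])
    also have "\<dots> = mtrace (B ^\<^sub>m k * Q * P)"
      using w Bk by (intro mtrace_mult_commute[of _ n]) auto
    also have "B ^\<^sub>m k * Q * P = B ^\<^sub>m k"
      using w Bk by (simp add: assoc_mult_mat[of _ n n _ n _ n])
    also have "mtrace (B ^\<^sub>m k) = (\<Sum>i<n. (B $$ (i,i)) ^ k)"
      using upper_triangular_pow_diag[OF B, of k] Bk unfolding mtrace_def by auto
    also have "\<dots> = (\<Sum>e\<leftarrow>diag_mat B. e ^ k)"
      using B(1) by (simp add: diag_mat_def interv_sum_list_conv_sum_set_nat atLeast0LessThan o_def)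
    finally show ?thesis .
  qed
  ultimately show ?thesis using that by blast
qed

definition mat_lincomb :: "nat \<Rightarrow> nat \<Rightarrow> (nat \<Rightarrow> complex) \<Rightarrow> (nat \<Rightarrow> complex mat) \<Rightarrow> complex mat" where
  "mat_lincomb n r c F = mat n n (\<lambda>(i,j). \<Sum>k<r. c k * F k $$ (i,j))"

lemma mat_lincomb_carrier [simp]: "mat_lincomb n r c F \<in> carrier_mat n n"
  by (simp add: mat_lincomb_def)

lemma mult_mat_lincomb:
  assumes A: "A \<in> carrier_mat n n" and F: "\<And>k. F k \<in> carrier_mat n n"
  shows "A * mat_lincomb n r c F = mat_lincomb n r c (\<lambda>k. A * F k)"
    and "mat_lincomb n r c F * A = mat_lincomb n r c (\<lambda>k. F k * A)"
proof -
  show "A * mat_lincomb n r c F = mat_lincomb n r c (\<lambda>k. A * F k)"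
  proof (rule eq_matI)
    fix i j assume "i < dim_row (mat_lincomb n r c (\<lambda>k. A * F k))" "j < dim_col (mat_lincomb n r c (\<lambda>k. A * F k))"
    hence ij: "i < n" "j < n" by (auto simp: mat_lincomb_def)
    have "(A * mat_lincomb n r c F) $$ (i,j) = (\<Sum>l<n. \<Sum>k<r. A $$ (i,l) * (c k * F k $$ (l,j)))"
      by (subst mat_mult_entry[OF A _ ij]) (use ij in \<open>auto simp: mat_lincomb_def sum_distrib_left\<close>)
    also have "\<dots> = (\<Sum>k<r. c k * (\<Sum>l<n. A $$ (i,l) * F k $$ (l,j)))"
      by (subst sum.swap) (simp add: sum_distrib_left mult_ac)
    finally show "(A * mat_lincomb n r c F) $$ (i,j) = mat_lincomb n r c (\<lambda>k. A * F k) $$ (i,j)"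
      using ij by (simp add: mat_lincomb_def mat_mult_entry[OF A F] del: index_mult_mat(1))
  qed (use A in \<open>auto simp: mat_lincomb_def\<close>)
  show "mat_lincomb n r c F * A = mat_lincomb n r c (\<lambda>k. F k * A)"
  proof (rule eq_matI)
    fix i j assume "i < dim_row (mat_lincomb n r c (\<lambda>k. F k * A))" "j < dim_col (mat_lincomb n r c (\<lambda>k. F k * A))"
    hence ij: "i < n" "j < n" by (auto simp: mat_lincomb_def)
    have "(mat_lincomb n r c F * A) $$ (i,j) = (\<Sum>l<n. \<Sum>k<r. (c k * F k $$ (i,l)) * A $$ (l,j))"
      by (subst mat_mult_entry[OF _ A ij]) (use ij in \<open>auto simp: mat_lincomb_def sum_distrib_right\<close>)
    also have "\<dots> = (\<Sum>k<r. c k * (\<Sum>l<n. F k $$ (i,l) * A $$ (l,j)))"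
      by (subst sum.swap) (simp add: sum_distrib_left mult_ac)
    finally show "(mat_lincomb n r c F * A) $$ (i,j) = mat_lincomb n r c (\<lambda>k. F k * A) $$ (i,j)"
      using ij by (simp add: mat_lincomb_def mat_mult_entry[OF F A] del: index_mult_mat(1))
  qed (use A in \<open>auto simp: mat_lincomb_def\<close>)
qed

lemma mtrace_lincomb:
  "(\<And>k. F k \<in> carrier_mat n n) \<Longrightarrow> mtrace (mat_lincomb n r c F) = (\<Sum>k<r. c k * mtrace (F k))"
  by (simp add: mtrace_def mat_lincomb_def carrier_matD(1)[of "F _" n n] sum_distrib_left)
     (rule sum.swap)

lemma sum_powers_root_of_unity:
  fixes x :: complex
  assumes "x ^ r = 1" "x \<noteq> 1"
  shows "(\<Sum>i<r. x ^ i) = 0"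
  using geometric_sum[OF assms(2), of r] assms(1) by simp

lemma cis_root_of_unity_eq_1_iff:
  assumes "r > 0"
  shows "cis (2 * pi * of_int j / of_nat r) = 1 \<longleftrightarrow> int r dvd j"
proof
  assume "cis (2 * pi * of_int j / of_nat r) = 1"
  hence "cos (2 * pi * of_int j / of_nat r) = 1" by (simp add: complex_eq_iff)
  then obtain n :: int where "2 * pi * of_int j / of_nat r = of_int n * 2 * pi"
    by (auto simp: cos_one_2pi_int)
  hence "real_of_int j = of_int (n * int r)" using assms by (simp add: field_simps)
  hence "j = n * int r" by linarith
  thus "int r dvd j" by simp
next
  assume "int r dvd j"
  then obtain n where "j = int r * n" by (elim dvdE)
  hence "2 * pi * of_int j / of_nat r = 2 * pi * of_int n" using assms by simp
  thus "cis (2 * pi * of_int j / of_nat r) = 1" by (simp add: complex_eq_iff)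
qed

text \<open>The matrices \<open>P i\<close> of the proof are the projections onto the eigenspaces of \<open>N\<close>; since they
  commute with \<open>M\<close>, the lists \<open>es i\<close> can be taken to be the spectra of \<open>P i * M\<close>.\<close>

lemma mtrace_commuting_finite_order:
  assumes N: "N \<in> carrier_mat n n" and M: "M \<in> carrier_mat n n"
    and comm: "N * M = M * N" and ord: "N ^\<^sub>m r = 1\<^sub>m n" and r: "r \<ge> 2"
  defines "w \<equiv> cis (2 * pi / of_nat r)"
  obtains es :: "nat \<Rightarrow> complex list" where
    "\<And>k. k \<ge> 1 \<Longrightarrow> mtrace (N * M ^\<^sub>m k) = (\<Sum>i<r. w ^ i * (\<Sum>e\<leftarrow>es i. e ^ k))"
proof -
  let ?u = "inverse w"
  have w0: "w \<noteq> 0" by (simp add: w_def)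
  have wr: "w ^ r = 1" using r by (simp add: w_def DeMoivre)
  \<comment> \<open>Fourier coefficients of the cyclic group of order \<open>r\<close>, with respect
    to the inverse of the character with value \<open>w ^ i\<close> at the generator.\<close>
  define c where "c = (\<lambda>i k. ?u ^ (i * k) / of_nat r :: complex)"
  define P where "P = (\<lambda>i. mat_lincomb n r (c i) (\<lambda>k. N ^\<^sub>m k))"
  have P [simp]: "P i \<in> carrier_mat n n" for i by (simp add: P_def)
  have [simp]: "dim_row (P i) = n" "dim_col (P i) = n" for i by (simp_all add: P_def mat_lincomb_def)
  have Nk [simp]: "N ^\<^sub>m k \<in> carrier_mat n n" for k using N by simp
  have Mk [simp]: "M ^\<^sub>m k \<in> carrier_mat n n" for k using M by simp
  have assoc: "A * B * C = A * (B * C)" if "A \<in> carrier_mat n n" "B \<in> carrier_mat n n"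
    "C \<in> carrier_mat n n" for A B C :: "complex mat" using that by (rule assoc_mult_mat)
  have N_pow: "N * N ^\<^sub>m k = N ^\<^sub>m Suc k" for k
  proof (induction k)
    case (Suc k)
    have "N * N ^\<^sub>m Suc k = N * N ^\<^sub>m k * N" using N by (simp add: assoc)
    thus ?case using Suc by simp
  qed (use N in auto)
  have NP: "N * P i = w ^ i \<cdot>\<^sub>m P i" for i
  proof (rule eq_matI)
    fix a b assume "a < dim_row (w ^ i \<cdot>\<^sub>m P i)" "b < dim_col (w ^ i \<cdot>\<^sub>m P i)"
    hence ab: "a < n" "b < n" using P[of i] by auto
    define g where "g = (\<lambda>k. c i k * (N ^\<^sub>m k) $$ (a,b))"
    have "?u ^ (i * r) = 1" using wr by (simp add: mult.commute[of i r] power_mult power_inverse)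
    \<comment> \<open>Because the \<open>r\<close>-th power of \<open>N\<close> is the identity,
      multiplication by \<open>N\<close> only shifts the summation index cyclically.\<close>
    hence "g r = g 0" using N by (simp add: g_def c_def ord)
    hence shift: "(\<Sum>k<r. g (Suc k)) = (\<Sum>k<r. g k)"
      using sum.lessThan_Suc_shift[of g r] sum.lessThan_Suc[of g r] by simp
    have cS: "c i k = w ^ i * c i (Suc k)" for k
      using w0 by (simp add: c_def power_add field_simps)
    have "N * P i = mat_lincomb n r (c i) (\<lambda>k. N ^\<^sub>m Suc k)"
      unfolding P_def by (subst mult_mat_lincomb(1)[OF N]) (simp_all only: Nk N_pow)
    hence "(N * P i) $$ (a,b) = (\<Sum>k<r. c i k * (N ^\<^sub>m Suc k) $$ (a,b))"
      using ab by (simp add: mat_lincomb_def)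
    also have "\<dots> = w ^ i * (\<Sum>k<r. g (Suc k))"
      unfolding g_def sum_distrib_left by (intro sum.cong refl, subst cS) simp
    also have "\<dots> = (w ^ i \<cdot>\<^sub>m P i) $$ (a,b)"
      using ab unfolding shift by (simp add: P_def mat_lincomb_def g_def)
    finally show "(N * P i) $$ (a,b) = (w ^ i \<cdot>\<^sub>m P i) $$ (a,b)" .
  qed (use N P[of i] in auto)
  have NkP: "N ^\<^sub>m k * P i = w ^ (i * k) \<cdot>\<^sub>m P i" for i k
  proof (induction k)
    case 0
    thus ?case using N P[of i] by auto
  next
    case (Suc k)
    have "N ^\<^sub>m Suc k * P i = N * (N ^\<^sub>m k * P i)"
      unfolding N_pow[symmetric] using N by (simp add: assoc)
    also have "\<dots> = w ^ (i * k) \<cdot>\<^sub>m (w ^ i \<cdot>\<^sub>m P i)"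
      unfolding Suc NP[symmetric] by (rule mult_smult_distrib[OF N P])
    also have "\<dots> = w ^ (i * Suc k) \<cdot>\<^sub>m P i" by (auto simp: power_add)
    finally show ?case .
  qed
  have PP: "P i * P i = P i" for i
  proof (rule eq_matI)
    fix a b assume "a < dim_row (P i)" "b < dim_col (P i)"
    hence ab: "a < n" "b < n" using P[of i] by auto
    have "P i * P i = mat_lincomb n r (c i) (\<lambda>k. N ^\<^sub>m k * P i)"
      by (subst (1) P_def) (rule mult_mat_lincomb(2)[OF P Nk])
    hence "(P i * P i) $$ (a,b) = (\<Sum>k<r. c i k * (w ^ (i * k) * P i $$ (a,b)))"
      using ab P[of i] by (simp add: NkP mat_lincomb_def)
    also have "\<dots> = (\<Sum>k<r. P i $$ (a,b) / of_nat r)"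
      using w0 by (intro sum.cong refl) (simp add: c_def power_inverse field_simps)
    also have "\<dots> = P i $$ (a,b)" using r by simp
    finally show "(P i * P i) $$ (a,b) = P i $$ (a,b)" .
  qed (use P[of i] in auto)
  have MN: "M * N ^\<^sub>m k = N ^\<^sub>m k * M" for k
  proof (induction k)
    case 0
    thus ?case using M N by auto
  next
    case (Suc k)
    have "M * N ^\<^sub>m Suc k = (N ^\<^sub>m k * M) * N"
      using M N by (simp add: Suc[symmetric] assoc)
    also have "\<dots> = N ^\<^sub>m Suc k * M" using M N comm by (simp add: assoc)
    finally show ?case .
  qed
  have MP: "M * P i = P i * M" for i
    unfolding P_def mult_mat_lincomb[OF M Nk] MN ..
  have MkP: "M ^\<^sub>m k * P i = P i * M ^\<^sub>m k" for i k
  proof (induction k)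
    case 0
    thus ?case using M P[of i] by auto
  next
    case (Suc k)
    have "M ^\<^sub>m Suc k * P i = M ^\<^sub>m k * P i * M" using M by (simp add: assoc MP)
    thus ?case unfolding Suc using M by (simp add: assoc)
  qed
  \<comment> \<open>An idempotent that commutes with \<open>M\<close> can be collected into a single
    factor. At exponent 0 the left side would be the identity instead of \<open>P i\<close>, so
    power sums are compared from exponent 1 on.\<close>
  have PM: "(P i * M) ^\<^sub>m k = P i * M ^\<^sub>m k" if "k \<ge> 1" for i k
    using that
  proof (induction k rule: dec_induct)
    case base
    thus ?case using M P[of i] by simp
  next
    case (step k)
    have "(P i * M) ^\<^sub>m Suc k = P i * (M ^\<^sub>m k * P i) * M"
      using step M by (simp add: assoc mult_carrier_mat[of _ n n _ n])
    also have "\<dots> = (P i * P i) * M ^\<^sub>m k * M"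
      unfolding MkP using M by (simp add: assoc mult_carrier_mat[of _ n n _ n])
    finally show ?case unfolding PP using M by (simp add: assoc)
  qed
  have trP: "mtrace (P i * Y) = (\<Sum>k<r. c i k * mtrace (N ^\<^sub>m k * Y))" if Y: "Y \<in> carrier_mat n n" for i Y
    unfolding P_def mult_mat_lincomb(2)[OF Y Nk] by (intro mtrace_lincomb mult_carrier_mat[OF Nk Y])
  \<comment> \<open>Fourier inversion: weighting the coefficients of the \<open>P i\<close> by
    \<open>w ^ i\<close> recovers the first power of \<open>N\<close> alone.\<close>
  have orth: "(\<Sum>i<r. w ^ i * c i k) = (if k = 1 then 1 else 0)" if k: "k < r" for k
  proof -
    define x where "x = w * ?u ^ k"
    have "w ^ i * c i k = x ^ i / of_nat r" for i
      by (simp add: c_def x_def power_mult_distrib power_mult[symmetric] mult.commute)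
    hence sum_eq: "(\<Sum>i<r. w ^ i * c i k) = (\<Sum>i<r. x ^ i) / of_nat r"
      by (simp add: sum_divide_distrib)
    show ?thesis
    proof (cases "k = 1")
      case True
      hence "x = 1" using w0 by (simp add: x_def)
      thus ?thesis using True r sum_eq by simp
    next
      case False
      have x_cis: "x = cis (2 * pi * of_int (1 - int k) / of_nat r)"
        by (simp add: x_def w_def DeMoivre cis_mult diff_divide_distrib algebra_simps)
      \<comment> \<open>For \<open>k < r\<close> the number \<open>1 - k\<close> has absolute value
        less than \<open>r\<close>, where the case \<open>k = 0\<close> relies on
        \<open>r \<ge> 2\<close>; so only \<open>k = 1\<close> gives divisibility.\<close>
      have "\<not> int r dvd 1 - int k"
        using False k r zdvd_imp_le[of "int r" "int k - 1"] zdvd_imp_le[of "int r" "1 - int k"]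
        by (cases "k = 0") (auto simp: dvd_diff_commute)
      hence "x \<noteq> 1" unfolding x_cis using cis_root_of_unity_eq_1_iff[of r "1 - int k"] r by simp
      moreover have "x ^ r = 1"
        using wr by (simp add: x_def power_mult_distrib power_inverse power_mult[symmetric])
          (metis mult.commute power_mult power_one)
      ultimately show ?thesis using sum_powers_root_of_unity False sum_eq by simp
    qed
  qed
  have "\<exists>es. \<forall>k. mtrace ((P i * M) ^\<^sub>m k) = (\<Sum>e\<leftarrow>es. e ^ k)" for i
    using mtrace_pow_eq_power_sum[of "P i * M" n] P[of i] M by (metis mult_carrier_mat)
  then obtain es where es: "\<And>i k. mtrace ((P i * M) ^\<^sub>m k) = (\<Sum>e\<leftarrow>es i. e ^ k)" by metis
  have "mtrace (N * M ^\<^sub>m k) = (\<Sum>i<r. w ^ i * (\<Sum>e\<leftarrow>es i. e ^ k))" if k: "k \<ge> 1" for k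
  proof -
    have "(\<Sum>i<r. w ^ i * (\<Sum>e\<leftarrow>es i. e ^ k)) = (\<Sum>i<r. \<Sum>l<r. (w ^ i * c i l) * mtrace (N ^\<^sub>m l * M ^\<^sub>m k))"
      by (simp add: es[symmetric] PM[OF k] trP sum_distrib_left mult.assoc)
    also have "\<dots> = (\<Sum>l<r. (\<Sum>i<r. w ^ i * c i l) * mtrace (N ^\<^sub>m l * M ^\<^sub>m k))"
      by (subst sum.swap) (simp add: sum_distrib_right)
    also have "\<dots> = (\<Sum>l<r. if l = 1 then mtrace (N ^\<^sub>m l * M ^\<^sub>m k) else 0)"
      by (intro sum.cong refl) (simp add: orth)
    also have "\<dots> = mtrace (N * M ^\<^sub>m k)" using r N by simp
    finally show ?thesis by simp
  qed
  thus ?thesis using that by blast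
qed

lemma sum_list_eq_sum_count:
  fixes f :: "complex \<Rightarrow> complex"
  assumes "finite S" "set xs \<subseteq> insert 0 S" "0 \<notin> S" "f 0 = 0"
  shows "(\<Sum>x\<leftarrow>xs. f x) = (\<Sum>z\<in>S. of_nat (count_list xs z) * f z)"
  using assms(2)
proof (induction xs)
  case (Cons x xs)
  have "(\<Sum>z\<in>S. of_nat (count_list (x # xs) z) * f z)
      = (\<Sum>z\<in>S. (if z = x then f z else 0) + of_nat (count_list xs z) * f z)"
    by (intro sum.cong) (auto simp: algebra_simps)
  also have "\<dots> = (if x \<in> S then f x else 0) + (\<Sum>x\<leftarrow>xs. f x)"
    using Cons assms(1) by (simp add: sum.distrib)
  also have "(if x \<in> S then f x else 0) = f x" using Cons.prems assms by auto
  finally show ?case by simp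
qed simp

text \<open>The trace of \<open>N\<close> times a power of \<open>M\<close> is a power sum over
  eigenvalues in two ways: by \<open>mtrace_commuting_finite_order\<close> with coefficients that
  are sums of roots of unity, and by \<open>tr\<close> with the multiplicities times
  \<open>(z / q) ^ 2\<close>. The coefficients of each nonzero eigenvalue agree, and the former are
  algebraic integers.\<close>

lemma algebraic_int_multiplicity_times_square:
  fixes q :: complex
  assumes N: "N \<in> carrier_mat n n" and M: "M \<in> carrier_mat n n"
    and comm: "N * M = M * N" and ord: "N ^\<^sub>m r = 1\<^sub>m n" and r: "r \<ge> 2"
    and tr: "\<And>k. k \<ge> 1 \<Longrightarrow> mtrace (N * M ^\<^sub>m k) = mtrace (M ^\<^sub>m (k + 2)) / q ^ 2"
    and es: "\<And>k. mtrace (M ^\<^sub>m k) = (\<Sum>e\<leftarrow>es. e ^ k)" and z0: "z \<noteq> 0"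
  shows "algebraic_int (of_nat (count_list es z) * (z / q) ^ 2)"
proof -
  define w where "w = cis (2 * pi / of_nat r)"
  obtain fs where fs: "\<And>k. k \<ge> 1 \<Longrightarrow> mtrace (N * M ^\<^sub>m k) = (\<Sum>i<r. w ^ i * (\<Sum>e\<leftarrow>fs i. e ^ k))"
    using mtrace_commuting_finite_order[OF N M comm ord r] unfolding w_def by metis
  \<comment> \<open>A common finite support for all spectra. The eigenvalue 0 is removed, since
    power sums with positive exponents do not see it.\<close>
  define S where "S = (insert z (set es \<union> (\<Union>i<r. set (fs i)))) - {0}"
  have S: "finite S" "0 \<notin> S" "z \<in> S" using z0 by (auto simp: S_def)
  define d where "d = (\<lambda>s. (\<Sum>i<r. w ^ i * of_nat (count_list (fs i) s)) - of_nat (count_list es s) * (s / q) ^ 2)"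
  have "d z = 0"
  proof (rule power_sums_zero_imp_zero[OF S])
    fix k :: nat assume k: "k \<ge> 1"
    have "(\<Sum>i<r. w ^ i * (\<Sum>e\<leftarrow>fs i. e ^ k)) = (\<Sum>i<r. w ^ i * (\<Sum>s\<in>S. of_nat (count_list (fs i) s) * s ^ k))"
      using k S by (intro sum.cong arg_cong2[where f = "(*)"] refl sum_list_eq_sum_count) (auto simp: S_def)
    also have "\<dots> = (\<Sum>s\<in>S. (\<Sum>i<r. w ^ i * of_nat (count_list (fs i) s)) * s ^ k)"
      by (simp add: sum_distrib_left sum_distrib_right mult.assoc) (rule sum.swap)
    finally have 1: "mtrace (N * M ^\<^sub>m k) = \<dots>" using fs[OF k] by simp
    have "(\<Sum>e\<leftarrow>es. e ^ (k + 2)) = (\<Sum>s\<in>S. of_nat (count_list es s) * s ^ (k + 2))"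
      using S by (intro sum_list_eq_sum_count) (auto simp: S_def)
    hence "mtrace (N * M ^\<^sub>m k) = (\<Sum>s\<in>S. of_nat (count_list es s) * (s / q) ^ 2 * s ^ k)"
      unfolding tr[OF k] es by (simp add: sum_divide_distrib power_add power_divide power2_eq_square mult_ac)
    with 1 show "(\<Sum>s\<in>S. d s * s ^ k) = 0"
      by (simp add: d_def left_diff_distrib sum_subtractf)
  qed
  hence "of_nat (count_list es z) * (z / q) ^ 2 = (\<Sum>i<r. w ^ i * of_nat (count_list (fs i) z))"
    by (simp add: d_def)
  moreover have w: "algebraic_int w"
    by (rule algebraic_int_of_power[of _ r]) (use r in \<open>auto simp: w_def DeMoivre intro: int_imp_algebraic_int\<close>)
  ultimately show ?thesis
    by (simp only:) (intro algebraic_int_sum algebraic_int_mult algebraic_int_power w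
      int_imp_algebraic_int[OF Ints_of_nat])
qed

section \<open>Matrices indexed by a finite set\<close>

definition fun_mat :: "(nat \<Rightarrow> 'a) \<Rightarrow> nat \<Rightarrow> ('a \<Rightarrow> 'a \<Rightarrow> complex) \<Rightarrow> complex mat" where
  "fun_mat b n F = mat n n (\<lambda>(i,j). F (b i) (b j))"

lemma fun_mat_carrier [simp]: "fun_mat b n F \<in> carrier_mat n n"
  by (simp add: fun_mat_def)

lemma fun_mat_cong:
  assumes "bij_betw b {..<n} A" "\<And>x y. x \<in> A \<Longrightarrow> y \<in> A \<Longrightarrow> F x y = H x y"
  shows "fun_mat b n F = fun_mat b n H"
  using assms by (auto simp: fun_mat_def bij_betw_def intro!: eq_matI)

lemma fun_mat_mult:
  assumes "bij_betw b {..<n} A"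
  shows "fun_mat b n F * fun_mat b n H = fun_mat b n (\<lambda>x y. \<Sum>z\<in>A. F x z * H z y)"
proof (rule eq_matI)
  fix i j assume "i < dim_row (fun_mat b n (\<lambda>x y. \<Sum>z\<in>A. F x z * H z y))"
    "j < dim_col (fun_mat b n (\<lambda>x y. \<Sum>z\<in>A. F x z * H z y))"
  hence ij: "i < n" "j < n" by (auto simp: fun_mat_def)
  have "(fun_mat b n F * fun_mat b n H) $$ (i,j) = (\<Sum>k<n. F (b i) (b k) * H (b k) (b j))"
    by (subst mat_mult_entry[OF _ _ ij]) (use ij in \<open>auto simp: fun_mat_def\<close>)
  also have "\<dots> = (\<Sum>z\<in>A. F (b i) z * H z (b j))" by (rule sum.reindex_bij_betw[OF assms])
  finally show "(fun_mat b n F * fun_mat b n H) $$ (i,j)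
      = fun_mat b n (\<lambda>x y. \<Sum>z\<in>A. F x z * H z y) $$ (i,j)"
    using ij by (simp add: fun_mat_def)
qed (auto simp: fun_mat_def)

lemma mtrace_fun_mat:
  assumes "bij_betw b {..<n} A"
  shows "mtrace (fun_mat b n F) = (\<Sum>x\<in>A. F x x)"
  using sum.reindex_bij_betw[OF assms, of "\<lambda>x. F x x"] by (simp add: mtrace_def fun_mat_def)

lemma one_mat_fun_mat:
  assumes "bij_betw b {..<n} A"
  shows "1\<^sub>m n = fun_mat b n (\<lambda>x y. if x = y then 1 else 0)"
  using assms by (auto simp: fun_mat_def bij_betw_def inj_on_def intro!: eq_matI)

lemma eigenvalue_fun_mat:
  assumes b: "bij_betw b {..<n} A" and ev: "eigenvalue (fun_mat b n F) e"
  obtains f x0 where "x0 \<in> A" "f x0 \<noteq> 0" "\<And>x. x \<in> A \<Longrightarrow> (\<Sum>y\<in>A. F x y * f y) = e * f x"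
proof -
  obtain v where "eigenvector (fun_mat b n F) v e" using ev unfolding eigenvalue_def by blast
  hence v: "v \<in> carrier_vec n" "v \<noteq> 0\<^sub>v n" "fun_mat b n F *\<^sub>v v = e \<cdot>\<^sub>v v"
    by (auto simp: eigenvector_def fun_mat_def)
  define f where "f = (\<lambda>x. v $ the_inv_into {..<n} b x)"
  have fb: "f (b i) = v $ i" if "i < n" for i
    using b that by (simp add: f_def the_inv_into_f_f bij_betw_def)
  obtain i where i: "i < n" "v $ i \<noteq> 0" using v(1,2) by (metis carrier_vecD eq_vecI index_zero_vec)
  have "(\<Sum>y\<in>A. F x y * f y) = e * f x" if x: "x \<in> A" for x
  proof -
    obtain k where k: "k < n" "x = b k" using b x by (auto simp: bij_betw_def)
    have "(\<Sum>y\<in>A. F x y * f y) = (\<Sum>j<n. F x (b j) * f (b j))"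
      using sum.reindex_bij_betw[OF b, of "\<lambda>y. F x y * f y"] by simp
    also have "\<dots> = (fun_mat b n F *\<^sub>v v) $ k"
      using k v(1) by (auto simp: fun_mat_def scalar_prod_def fb atLeast0LessThan intro!: sum.cong)
    also have "\<dots> = e * f x" using k v(1) fb by (simp add: v(3))
    finally show ?thesis .
  qed
  thus ?thesis using that[of "b i" f] i b fb by (auto simp: bij_betw_def)
qed

lemma eigenvalue_fun_matI:
  assumes b: "bij_betw b {..<n} A" and "x0 \<in> A" "f x0 \<noteq> 0"
    "\<And>x. x \<in> A \<Longrightarrow> (\<Sum>y\<in>A. F x y * f y) = e * f x"
  shows "eigenvalue (fun_mat b n F) e"
proof -
  define v where "v = vec n (\<lambda>i. f (b i))"
  have bA: "b i \<in> A" if "i < n" for i using b that by (auto simp: bij_betw_def)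
  obtain k where k: "k < n" "b k = x0" using b assms(2) by (auto simp: bij_betw_def)
  have "eigenvector (fun_mat b n F) v e"
    unfolding eigenvector_def
  proof (intro conjI)
    show "v \<in> carrier_vec (dim_row (fun_mat b n F))" by (simp add: v_def fun_mat_def)
    have "v $ k \<noteq> 0" using k assms(3) by (simp add: v_def)
    thus "v \<noteq> 0\<^sub>v (dim_row (fun_mat b n F))" using k by (auto simp: fun_mat_def)
    show "fun_mat b n F *\<^sub>v v = e \<cdot>\<^sub>v v"
    proof (rule eq_vecI)
      fix i assume "i < dim_vec (e \<cdot>\<^sub>v v)"
      hence i: "i < n" by (simp add: v_def)
      have "(fun_mat b n F *\<^sub>v v) $ i = (\<Sum>j<n. F (b i) (b j) * f (b j))"
        using i by (simp add: fun_mat_def v_def scalar_prod_def atLeast0LessThan)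
      also have "\<dots> = (\<Sum>y\<in>A. F (b i) y * f y)" by (rule sum.reindex_bij_betw[OF b])
      finally show "(fun_mat b n F *\<^sub>v v) $ i = (e \<cdot>\<^sub>v v) $ i"
        using i assms(4)[OF bA[OF i]] by (simp add: v_def)
    qed (simp add: fun_mat_def v_def)
  qed
  thus ?thesis unfolding eigenvalue_def by blast
qed

text \<open>The equality case of the triangle inequality. Each real part of
  \<open>a t * cnj u\<close> is at most the squared norm of \<open>u\<close>, and the sum forces
  equality in every term; expanding the squared distance between \<open>a s\<close> and
  \<open>u\<close> then leaves nothing positive.\<close>

lemma sum_eq_bound_imp_eq:
  fixes a :: "'i \<Rightarrow> complex"
  assumes fin: "finite S" and s: "s \<in> S" and bound: "\<And>t. t \<in> S \<Longrightarrow> norm (a t) \<le> norm u"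
    and sum: "(\<Sum>t\<in>S. a t) = of_nat (card S) * u"
  shows "a s = u"
proof -
  have Re_le: "Re (a t * cnj u) \<le> (norm u)\<^sup>2" if "t \<in> S" for t
  proof -
    have "Re (a t * cnj u) \<le> norm (a t) * norm u" by (metis complex_Re_le_cmod complex_mod_cnj norm_mult)
    also have "\<dots> \<le> norm u * norm u" using bound[OF that] by (intro mult_right_mono) auto
    finally show ?thesis by (simp add: power2_eq_square)
  qed
  have "(\<Sum>t\<in>S. (norm u)\<^sup>2 - Re (a t * cnj u)) = of_nat (card S) * (norm u)\<^sup>2 - Re ((\<Sum>t\<in>S. a t) * cnj u)"
    by (simp add: sum_subtractf sum_distrib_right Re_sum)
  also have "(\<Sum>t\<in>S. a t) * cnj u = complex_of_real (of_nat (card S) * (norm u)\<^sup>2)"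
    by (simp add: sum mult.assoc complex_norm_square[symmetric])
  finally have "(\<Sum>t\<in>S. (norm u)\<^sup>2 - Re (a t * cnj u)) = 0" by simp
  hence Re_eq: "Re (a s * cnj u) = (norm u)\<^sup>2"
    using sum_nonneg_eq_0_iff[OF fin, of "\<lambda>t. (norm u)\<^sup>2 - Re (a t * cnj u)"] Re_le s by auto
  have "(norm (a s - u))\<^sup>2 = (norm (a s))\<^sup>2 + (norm u)\<^sup>2 - 2 * Re (a s * cnj u)"
    by (simp only: cmod_power2) (simp add: power2_eq_square algebra_simps)
  also have "\<dots> \<le> 0" using Re_eq bound[OF s] by (simp add: power_mono)
  finally show ?thesis by simp
qed

text \<open>The radical of the ideal generated by \<open>p\<close> in the ring of algebraic
  integers. It stands in for a maximal ideal above \<open>p\<close>, which would have to be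
  chosen.\<close>

definition alg_int_rad :: "nat \<Rightarrow> complex set" where
  "alg_int_rad p = {x. algebraic_int x \<and> (\<exists>k. algebraic_int (x ^ k / of_nat p))}"

text \<open>Every term in the binomial expansion of \<open>(x + y) ^ (k + l)\<close> contains
  \<open>x ^ k\<close> or \<open>y ^ l\<close>, so it is divisible by \<open>p\<close>.\<close>

lemma alg_int_rad_add:
  assumes "x \<in> alg_int_rad p" "y \<in> alg_int_rad p"
  shows "x + y \<in> alg_int_rad p"
proof -
  obtain k l where xy: "algebraic_int x" "algebraic_int y"
    and k: "algebraic_int (x ^ k / of_nat p)" and l: "algebraic_int (y ^ l / of_nat p)"
    using assms by (auto simp: alg_int_rad_def)
  have "algebraic_int (of_nat (k + l choose i) * x ^ i * y ^ (k + l - i) / of_nat p)"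
    if i: "i \<le> k + l" for i
  proof (cases "k \<le> i")
    case True
    hence "x ^ i = x ^ k * x ^ (i - k)" by (simp add: power_add[symmetric])
    hence eq: "of_nat (k + l choose i) * x ^ i * y ^ (k + l - i) / of_nat p
        = of_nat (k + l choose i) * (x ^ k / of_nat p) * x ^ (i - k) * y ^ (k + l - i)" by simp
    show ?thesis unfolding eq
      by (intro algebraic_int_mult algebraic_int_power int_imp_algebraic_int[OF Ints_of_nat] xy k)
  next
    case False
    hence "y ^ (k + l - i) = y ^ l * y ^ (k - i)" by (simp add: power_add[symmetric] add.commute)
    hence eq: "of_nat (k + l choose i) * x ^ i * y ^ (k + l - i) / of_nat p
        = of_nat (k + l choose i) * x ^ i * (y ^ l / of_nat p) * y ^ (k - i)" by simp
    show ?thesis unfolding eq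
      by (intro algebraic_int_mult algebraic_int_power int_imp_algebraic_int[OF Ints_of_nat] xy l)
  qed
  hence "algebraic_int (\<Sum>i\<le>k + l. of_nat (k + l choose i) * x ^ i * y ^ (k + l - i) / of_nat p)"
    by (intro algebraic_int_sum) auto
  hence "algebraic_int ((x + y) ^ (k + l) / of_nat p)"
    by (simp add: binomial_ring sum_divide_distrib)
  thus ?thesis using xy by (auto simp: alg_int_rad_def intro: algebraic_int_add)
qed

lemma alg_int_rad_sum:
  assumes "p > 0" "\<And>i. i \<in> I \<Longrightarrow> f i \<in> alg_int_rad p"
  shows "(\<Sum>i\<in>I. f i) \<in> alg_int_rad p"
proof -
  have "0 \<in> alg_int_rad p" by (auto simp: alg_int_rad_def intro!: exI[of _ 1])
  thus ?thesis using assms(2)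
    by (induction I rule: infinite_finite_induct) (auto intro: alg_int_rad_add)
qed

text \<open>A power of -1 divided by \<open>p\<close> is rational; as an algebraic integer it would
  be an integer, but its absolute value lies strictly between 0 and 1.\<close>

lemma minus_one_notin_alg_int_rad:
  assumes "p > 1"
  shows "-1 \<notin> alg_int_rad p"
proof
  assume "-1 \<in> alg_int_rad p"
  then obtain k where k: "algebraic_int ((-1) ^ k / of_nat p :: complex)" by (auto simp: alg_int_rad_def)
  hence "((-1) ^ k / of_nat p :: complex) \<in> \<int>" by (rule rational_algebraic_int_is_int) auto
  then obtain j :: int where j: "((-1) ^ k / of_nat p :: complex) = of_int j" by (auto elim: Ints_cases)
  have "norm ((-1) ^ k / of_nat p :: complex) = 1 / p" by (simp add: norm_divide norm_power)
  hence "\<bar>real_of_int j\<bar> = 1 / p" unfolding j by simp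
  hence "real_of_int \<bar>j\<bar> < 1" "j \<noteq> 0" using assms by auto
  thus False by linarith
qed

section \<open>Conjugacy classes of prime power size\<close>

context group
begin

lemma inv_mult_cancel:
  assumes "x \<in> carrier G" "y \<in> carrier G"
  shows "inv x \<otimes> (x \<otimes> y) = y" "x \<otimes> (inv x \<otimes> y) = y"
  using assms by (simp_all add: m_assoc[symmetric])

lemma bij_mult_right: "y \<in> carrier G \<Longrightarrow> bij_betw (\<lambda>x. x \<otimes> y) (carrier G) (carrier G)"
  by (rule bij_betwI[where g = "\<lambda>x. x \<otimes> inv y"]) (auto simp: m_assoc)

lemma bij_mult_left: "y \<in> carrier G \<Longrightarrow> bij_betw (\<lambda>x. y \<otimes> x) (carrier G) (carrier G)"
  by (rule bij_betwI[where g = "\<lambda>x. inv y \<otimes> x"]) (auto simp: inv_mult_cancel)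

lemma bij_inv: "bij_betw (\<lambda>x. inv x) (carrier G) (carrier G)"
  by (rule bij_betwI[where g = "\<lambda>x. inv x"]) auto

lemma bij_conj: "y \<in> carrier G \<Longrightarrow> bij_betw (\<lambda>x. y \<otimes> x \<otimes> inv y) (carrier G) (carrier G)"
  by (rule bij_betwI[where g = "\<lambda>x. inv y \<otimes> x \<otimes> y"]) (auto simp: m_assoc inv_mult_cancel)

section \<open>Conjugacy classes and centralizers\<close>

definition conj_class :: "'a \<Rightarrow> 'a set" where
  "conj_class g = (\<lambda>x. x \<otimes> g \<otimes> inv x) ` carrier G"

definition centralizer_of :: "'a \<Rightarrow> 'a set" where
  "centralizer_of g = {x \<in> carrier G. x \<otimes> g = g \<otimes> x}"

lemma conj_class_subset: "g \<in> carrier G \<Longrightarrow> conj_class g \<subseteq> carrier G"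
  by (auto simp: conj_class_def)

lemma conj_class_self: "g \<in> carrier G \<Longrightarrow> g \<in> conj_class g"
  by (auto simp: conj_class_def intro!: image_eqI[of _ _ \<one>])

lemma conj_class_conj:
  assumes "g \<in> carrier G" "v \<in> conj_class g" "y \<in> carrier G"
  shows "y \<otimes> v \<otimes> inv y \<in> conj_class g"
proof -
  obtain x where "x \<in> carrier G" "v = x \<otimes> g \<otimes> inv x" using assms(2) by (auto simp: conj_class_def)
  thus ?thesis using assms
    by (auto simp: conj_class_def m_assoc inv_mult_group intro!: image_eqI[of _ _ "y \<otimes> x"])
qed

lemma conj_class_comm:
  assumes "g \<in> carrier G" "x \<in> carrier G" "y \<in> carrier G" "x \<otimes> y \<in> conj_class g"
  shows "y \<otimes> x \<in> conj_class g"
  using conj_class_conj[OF assms(1,4), of y] assms by (simp add: m_assoc)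

text \<open>The fibre of \<open>z \<mapsto> z \<otimes> g \<otimes> inv z\<close> over the conjugate
  by \<open>x\<close> is the left coset of the centralizer of \<open>g\<close> through
  \<open>x\<close>, so every element of the class is hit equally often.\<close>

lemma sum_over_conjugates:
  fixes f :: "'a \<Rightarrow> complex"
  assumes fin: "finite (carrier G)" and g: "g \<in> carrier G"
  shows "(\<Sum>z\<in>carrier G. f (z \<otimes> g \<otimes> inv z)) = of_nat (card (centralizer_of g)) * (\<Sum>v\<in>conj_class g. f v)"
proof -
  have "(\<Sum>z\<in>carrier G. f (z \<otimes> g \<otimes> inv z))
      = (\<Sum>v\<in>conj_class g. \<Sum>z\<in>{z \<in> carrier G. z \<otimes> g \<otimes> inv z = v}. f (z \<otimes> g \<otimes> inv z))"
    using fin by (intro sum.group[symmetric]) (auto simp: conj_class_def)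
  also have "\<dots> = (\<Sum>v\<in>conj_class g. of_nat (card (centralizer_of g)) * f v)"
  proof (intro sum.cong refl)
    fix v assume "v \<in> conj_class g"
    then obtain x where x: "x \<in> carrier G" "v = x \<otimes> g \<otimes> inv x" by (auto simp: conj_class_def)
    have "bij_betw (\<lambda>c. x \<otimes> c) (centralizer_of g) {z \<in> carrier G. z \<otimes> g \<otimes> inv z = v}"
    proof (rule bij_betwI[where g = "\<lambda>z. inv x \<otimes> z"])
      show "(\<lambda>c. x \<otimes> c) \<in> centralizer_of g \<rightarrow> {z \<in> carrier G. z \<otimes> g \<otimes> inv z = v}"
      proof (intro funcsetI)
        fix c assume c: "c \<in> centralizer_of g"
        hence c': "c \<in> carrier G" "c \<otimes> g = g \<otimes> c" by (auto simp: centralizer_of_def)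
        have "(x \<otimes> c) \<otimes> g \<otimes> inv (x \<otimes> c) = x \<otimes> (c \<otimes> g) \<otimes> inv c \<otimes> inv x"
          using c'(1) x g by (simp add: m_assoc inv_mult_group)
        also have "\<dots> = v" unfolding c'(2) using c'(1) x g by (simp add: m_assoc inv_mult_cancel)
        finally show "x \<otimes> c \<in> {z \<in> carrier G. z \<otimes> g \<otimes> inv z = v}" using x c' by simp
      qed
      show "(\<lambda>z. inv x \<otimes> z) \<in> {z \<in> carrier G. z \<otimes> g \<otimes> inv z = v} \<rightarrow> centralizer_of g"
      proof (intro funcsetI)
        fix z assume "z \<in> {z \<in> carrier G. z \<otimes> g \<otimes> inv z = v}"
        hence z: "z \<in> carrier G" "z \<otimes> g \<otimes> inv z = x \<otimes> g \<otimes> inv x" using x by auto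
        have "inv x \<otimes> z \<otimes> g = inv x \<otimes> (z \<otimes> g \<otimes> inv z) \<otimes> z"
          using z(1) x g by (simp add: m_assoc)
        also have "\<dots> = g \<otimes> (inv x \<otimes> z)"
          unfolding z(2) using z(1) x g by (simp add: m_assoc inv_mult_cancel)
        finally show "inv x \<otimes> z \<in> centralizer_of g" using z x by (simp add: centralizer_of_def)
      qed
    qed (use x in \<open>auto simp: centralizer_of_def inv_mult_cancel\<close>)
    from bij_betw_same_card[OF this]
    show "(\<Sum>z\<in>{z \<in> carrier G. z \<otimes> g \<otimes> inv z = v}. f (z \<otimes> g \<otimes> inv z))
        = of_nat (card (centralizer_of g)) * f v" by simp
  qed
  finally show ?thesis by (simp add: sum_distrib_left)
qed

lemma order_eq_centralizer_times_class:
  assumes "finite (carrier G)" "g \<in> carrier G"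
  shows "Coset.order G = card (centralizer_of g) * card (conj_class g)"
proof -
  have "(of_nat (Coset.order G) :: complex) = of_nat (card (centralizer_of g) * card (conj_class g))"
    using sum_over_conjugates[OF assms, of "\<lambda>_. 1"] by (simp add: Coset.order_def)
  thus ?thesis by (simp only: of_nat_eq_iff)
qed

lemma centralizer_subgroup:
  assumes g: "g \<in> carrier G"
  shows "subgroup (centralizer_of g) G"
proof (rule subgroupI)
  fix x y assume x: "x \<in> centralizer_of g" and y: "y \<in> centralizer_of g"
  hence xy: "x \<in> carrier G" "y \<in> carrier G" "x \<otimes> g = g \<otimes> x" "y \<otimes> g = g \<otimes> y"
    by (auto simp: centralizer_of_def)
  have "x \<otimes> y \<otimes> g = x \<otimes> (g \<otimes> y)" using xy(1,2) g by (simp add: m_assoc xy(4))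
  also have "\<dots> = (x \<otimes> g) \<otimes> y" using xy(1,2) g by (simp add: m_assoc)
  also have "\<dots> = g \<otimes> (x \<otimes> y)" using xy(1,2) g by (simp only: xy(3) m_assoc)
  finally show "x \<otimes> y \<in> centralizer_of g" using x y by (simp add: centralizer_of_def)
next
  fix x assume x: "x \<in> centralizer_of g"
  hence xg: "x \<in> carrier G" "x \<otimes> g = g \<otimes> x" by (auto simp: centralizer_of_def)
  have "inv x \<otimes> g = inv x \<otimes> (g \<otimes> x) \<otimes> inv x" using xg(1) g by (simp add: m_assoc)
  also have "\<dots> = g \<otimes> inv x" unfolding xg(2)[symmetric] using xg(1) g by (simp add: m_assoc inv_mult_cancel)
  finally show "inv x \<in> centralizer_of g" using xg by (simp add: centralizer_of_def)
qed (use g in \<open>auto simp: centralizer_of_def\<close>)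

lemma subgroup_of_finite_mult_closed:
  assumes fin: "finite (carrier G)" and U: "U \<subseteq> carrier G" "U \<noteq> {}"
    and closed: "\<And>x y. x \<in> U \<Longrightarrow> y \<in> U \<Longrightarrow> x \<otimes> y \<in> U"
  shows "subgroup U G"
proof (rule subgroupI)
  fix x assume x: "x \<in> U"
  hence xG: "x \<in> carrier G" using U by blast
  have pow: "x [^] Suc k \<in> U" for k :: nat
    by (induction k) (use x xG closed in auto)
  have "Coset.order G > 0" using order_gt_0_iff_finite fin by simp
  \<comment> \<open>Only positive powers of \<open>x\<close> are known to lie in \<open>U\<close>.
    The exponent is twice the order minus 1, because the order minus 1 would be 0 in the trivial
    group.\<close>
  hence o: "x [^] (2 * Coset.order G - 1) \<otimes> x = \<one>" "2 * Coset.order G - 1 = Suc (2 * Coset.order G - 2)"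
    using pow_order_eq_1[OF xG] xG nat_pow_Suc[of x "2 * Coset.order G - 1"]
    by (simp_all add: nat_pow_mult[symmetric] mult_2)
  have "inv x = x [^] (2 * Coset.order G - 1)"
    by (rule inv_equality[OF o(1)]) (use xG in auto)
  thus "inv x \<in> U" using pow[of "2 * Coset.order G - 2"] o(2) by simp
qed (use U closed in auto)

section \<open>Class functions and convolution\<close>

definition class_fun :: "('a \<Rightarrow> complex) \<Rightarrow> bool" where
  "class_fun f \<longleftrightarrow> (\<forall>x\<in>carrier G. \<forall>y\<in>carrier G. f (x \<otimes> y) = f (y \<otimes> x))"

lemma class_funD: "class_fun f \<Longrightarrow> x \<in> carrier G \<Longrightarrow> y \<in> carrier G \<Longrightarrow> f (x \<otimes> y) = f (y \<otimes> x)"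
  by (auto simp: class_fun_def)

lemma class_fun_conj:
  assumes "class_fun f" "x \<in> carrier G" "y \<in> carrier G"
  shows "f (y \<otimes> x \<otimes> inv y) = f x"
  using class_funD[OF assms(1), of "y \<otimes> x" "inv y"] assms by (simp add: inv_mult_cancel)

definition conv :: "('a \<Rightarrow> complex) \<Rightarrow> ('a \<Rightarrow> complex) \<Rightarrow> 'a \<Rightarrow> complex" where
  "conv f h u = (\<Sum>w\<in>carrier G. f (u \<otimes> inv w) * h w)"

lemma class_fun_convolution:
  assumes "class_fun f" "class_fun h"
  shows "class_fun (conv f h)"
  unfolding class_fun_def
proof (intro ballI)
  fix x y assume xy: "x \<in> carrier G" "y \<in> carrier G"
  \<comment> \<open>Conjugating the summation variable by \<open>inv x\<close> leaves
    \<open>h\<close> unchanged, and \<open>f\<close>, being a class function, lets \<open>x\<close>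
    move to the front.\<close>
  have "conv f h (y \<otimes> x) = (\<Sum>w\<in>carrier G. f (y \<otimes> x \<otimes> inv (inv x \<otimes> w \<otimes> inv (inv x))) * h (inv x \<otimes> w \<otimes> inv (inv x)))"
    unfolding conv_def
    by (rule sum.reindex_bij_betw[OF bij_conj, of "inv x" "\<lambda>w. f (y \<otimes> x \<otimes> inv w) * h w", symmetric]) (use xy in auto)
  also have "\<dots> = (\<Sum>w\<in>carrier G. f (x \<otimes> y \<otimes> inv w) * h w)"
  proof (intro sum.cong refl arg_cong2[where f = "(*)"])
    fix w assume w: "w \<in> carrier G"
    show "h (inv x \<otimes> w \<otimes> inv (inv x)) = h w" by (rule class_fun_conj[OF assms(2)]) (use w xy in auto)
    have "y \<otimes> x \<otimes> inv (inv x \<otimes> w \<otimes> inv (inv x)) = (y \<otimes> inv w) \<otimes> x"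
      using w xy by (simp add: m_assoc inv_mult_group inv_mult_cancel)
    hence "f (y \<otimes> x \<otimes> inv (inv x \<otimes> w \<otimes> inv (inv x))) = f ((y \<otimes> inv w) \<otimes> x)" by simp
    also have "\<dots> = f (x \<otimes> (y \<otimes> inv w))" by (rule class_funD[OF assms(1)]) (use w xy in auto)
    finally show "f (y \<otimes> x \<otimes> inv (inv x \<otimes> w \<otimes> inv (inv x))) = f (x \<otimes> y \<otimes> inv w)"
      using w xy by (simp add: m_assoc)
  qed
  finally show "conv f h (x \<otimes> y) = conv f h (y \<otimes> x)" by (simp add: conv_def)
qed

lemma sum_convolution:
  "(\<Sum>u\<in>carrier G. conv f h u) = (\<Sum>u\<in>carrier G. f u) * (\<Sum>w\<in>carrier G. h w)"
proof -
  have "(\<Sum>u\<in>carrier G. conv f h u) = (\<Sum>w\<in>carrier G. (\<Sum>u\<in>carrier G. f (u \<otimes> inv w)) * h w)"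
    unfolding conv_def by (subst sum.swap) (simp add: sum_distrib_right)
  also have "\<dots> = (\<Sum>w\<in>carrier G. (\<Sum>u\<in>carrier G. f u) * h w)"
    by (intro sum.cong refl arg_cong2[where f = "(*)"] sum.reindex_bij_betw bij_mult_right) auto
  finally show ?thesis by (simp add: sum_distrib_left)
qed

text \<open>Matrices with entries \<open>f (x \<otimes> inv y)\<close> form the left regular
  representation of the group algebra, whose product is convolution.\<close>

lemma fun_mat_convolution:
  assumes b: "bij_betw b {..<n} (carrier G)"
  shows "fun_mat b n (\<lambda>x y. f (x \<otimes> inv y)) * fun_mat b n (\<lambda>x y. h (x \<otimes> inv y))
    = fun_mat b n (\<lambda>x y. conv f h (x \<otimes> inv y))"
  unfolding fun_mat_mult[OF b]
proof (rule fun_mat_cong[OF b])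
  fix x y assume xy: "x \<in> carrier G" "y \<in> carrier G"
  have "(\<Sum>z\<in>carrier G. f (x \<otimes> inv z) * h (z \<otimes> inv y))
      = (\<Sum>w\<in>carrier G. f (x \<otimes> inv (w \<otimes> y)) * h ((w \<otimes> y) \<otimes> inv y))"
    by (rule sum.reindex_bij_betw[OF bij_mult_right, of y "\<lambda>z. f (x \<otimes> inv z) * h (z \<otimes> inv y)", symmetric]) (use xy in auto)
  also have "\<dots> = conv f h (x \<otimes> inv y)"
    unfolding conv_def using xy by (intro sum.cong refl) (simp add: m_assoc inv_mult_group)
  finally show "(\<Sum>z\<in>carrier G. f (x \<otimes> inv z) * h (z \<otimes> inv y)) = conv f h (x \<otimes> inv y)" .
qed

end

section \<open>The class sum operator and its traces\<close>

locale finite_group_class = group +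
  fixes g
  assumes fin: "finite (carrier G)" and g: "g \<in> carrier G" and g1: "g \<noteq> \<one>"
begin

abbreviation K where "K \<equiv> conj_class g"
abbreviation q where "q \<equiv> (of_nat (card (conj_class g)) :: complex)"
abbreviation n where "n \<equiv> Coset.order G"

text \<open>The constant is subtracted to remove the eigenvalue \<open>q\<close> of the constant functions.\<close>

definition cind :: "'a \<Rightarrow> complex" where
  "cind x = (if x \<in> K then 1 else 0) - q / of_nat n"

text \<open>Convolution powers, starting from the unit of convolution; as a function of
  \<open>x \<otimes> inv y\<close> they are the entries of the powers of the corrected class sum
  operator.\<close>

definition cind_pow :: "nat \<Rightarrow> 'a \<Rightarrow> complex" where
  "cind_pow k = ((\<lambda>f. conv f cind) ^^ k) (\<lambda>x. if x = \<one> then 1 else 0)"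

lemma cind_pow_Suc: "cind_pow (Suc k) = conv (cind_pow k) cind"
  by (simp add: cind_pow_def)

lemma K: "K \<subseteq> carrier G" "finite K" "K \<noteq> {}"
  using conj_class_subset[OF g] fin conj_class_self[OF g] by (auto intro: finite_subset)

lemma n_ge_2: "n \<ge> 2"
proof -
  have "card {\<one>, g} \<le> n" unfolding Coset.order_def using fin g by (intro card_mono) auto
  thus ?thesis using g1 by simp
qed

lemma q0: "q \<noteq> 0"
  using K by auto

lemma one_notin_K: "\<one> \<notin> K"
proof
  assume "\<one> \<in> K"
  then obtain x where x: "x \<in> carrier G" "\<one> = x \<otimes> g \<otimes> inv x" by (auto simp: conj_class_def)
  have "g = inv x \<otimes> (x \<otimes> g \<otimes> inv x) \<otimes> x" using x(1) g by (simp add: m_assoc inv_mult_cancel)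
  also have "\<dots> = \<one>" unfolding x(2)[symmetric] using x(1) by simp
  finally show False using g1 by simp
qed

lemma class_fun_cind: "class_fun cind"
  unfolding class_fun_def cind_def using conj_class_comm[OF g] by auto

lemma class_fun_cind_pow: "class_fun (cind_pow k)"
proof (induction k)
  case 0
  have "x \<otimes> y = \<one> \<longleftrightarrow> y \<otimes> x = \<one>" if "x \<in> carrier G" "y \<in> carrier G" for x y
    using that inv_comm by blast
  thus ?case by (auto simp: cind_pow_def class_fun_def)
qed (auto simp: cind_pow_Suc class_fun_cind intro: class_fun_convolution)

lemma sum_K: "(\<Sum>x\<in>carrier G. if x \<in> K then f x else 0) = (\<Sum>x\<in>K. f x :: complex)"
  using fin K(1) by (simp add: sum.inter_restrict[symmetric] Int_absorb1)

lemma sum_cind: "(\<Sum>x\<in>carrier G. cind x) = 0"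
  using n_ge_2 K sum_K[of "\<lambda>_. 1"] by (simp add: cind_def sum_subtractf Coset.order_def)

lemma sum_cind_pow: "k \<ge> 1 \<Longrightarrow> (\<Sum>x\<in>carrier G. cind_pow k x) = 0"
  by (cases k) (auto simp: cind_pow_Suc sum_convolution sum_cind)

lemma sum_mult_cind:
  "(\<Sum>x\<in>carrier G. f x * cind x) = (\<Sum>x\<in>K. f x) - (\<Sum>x\<in>carrier G. f x) * (q / of_nat n)"
proof -
  have "(\<Sum>x\<in>carrier G. f x * cind x)
      = (\<Sum>x\<in>carrier G. if x \<in> K then f x else 0) - (\<Sum>x\<in>carrier G. f x * (q / of_nat n))"
    unfolding sum_subtractf[symmetric] by (intro sum.cong) (auto simp: cind_def algebra_simps)
  thus ?thesis by (simp only: sum_K sum_distrib_right)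
qed

text \<open>The identity for \<open>tr (N M^k)\<close>. Cyclically permuted, the argument on the
  left is \<open>inv g\<close> times the inverse of a conjugate of \<open>g\<close> that runs evenly
  over \<open>K\<close> as \<open>z\<close> varies. For a class function the factor
  \<open>inv g\<close> may be averaged over the inverses of \<open>K\<close> as well, and a double
  sum over \<open>K\<close> amounts to two further multiplications by the class sum.\<close>

lemma cind_pow_trace:
  assumes k: "k \<ge> 1"
  shows "(\<Sum>z\<in>carrier G. cind_pow k (z \<otimes> inv (g \<otimes> z \<otimes> g))) = of_nat n * cind_pow (k + 2) \<one> / q ^ 2"
proof -
  define h where "h = (\<lambda>w. \<Sum>v\<in>K. cind_pow k (inv w \<otimes> inv v))"
  have Kc: "x \<in> carrier G" if "x \<in> K" for x using K that by blast
  have shift0: "(\<Sum>v\<in>carrier G. cind_pow k (inv w \<otimes> inv v)) = 0" if w: "w \<in> carrier G" for w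
  proof -
    have "(\<Sum>v\<in>carrier G. cind_pow k (inv w \<otimes> inv v)) = (\<Sum>v\<in>carrier G. cind_pow k (inv w \<otimes> v))"
      by (rule sum.reindex_bij_betw[OF bij_inv, of "\<lambda>v. cind_pow k (inv w \<otimes> v)"])
    also have "\<dots> = (\<Sum>v\<in>carrier G. cind_pow k v)"
      by (rule sum.reindex_bij_betw[OF bij_mult_left]) (use w in auto)
    finally show ?thesis using sum_cind_pow[OF k] by simp
  qed
  \<comment> \<open>The constant in \<open>cind\<close> contributes only a multiple of the total sum
    of \<open>cind_pow k\<close>, which vanishes for positive \<open>k\<close>; so a further
    convolution is plain summation over \<open>K\<close>.\<close>
  have conv1: "conv (cind_pow k) cind (inv w) = h w" if w: "w \<in> carrier G" for w
    unfolding conv_def sum_mult_cind using shift0[OF w] by (simp add: h_def)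
  have sumh: "(\<Sum>w\<in>carrier G. h w) = 0"
  proof -
    have "(\<Sum>w\<in>carrier G. h w) = (\<Sum>v\<in>K. \<Sum>w\<in>carrier G. cind_pow k (inv v \<otimes> inv w))"
      unfolding h_def by (subst sum.swap) (intro sum.cong refl class_funD[OF class_fun_cind_pow], use Kc in auto)
    also have "\<dots> = 0" using shift0 Kc by simp
    finally show ?thesis .
  qed
  \<comment> \<open>Simultaneous conjugation of both factors does not change the value of a class
    function and permutes \<open>K\<close>.\<close>
  have h_class: "h w = h g" if w: "w \<in> K" for w
  proof -
    obtain x where x: "x \<in> carrier G" "w = x \<otimes> g \<otimes> inv x" using w by (auto simp: conj_class_def)
    have bK: "bij_betw (\<lambda>v. x \<otimes> v \<otimes> inv x) K K"
    proof (rule bij_betwI[where g = "\<lambda>v. inv x \<otimes> v \<otimes> x"])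
      show "(\<lambda>v. x \<otimes> v \<otimes> inv x) \<in> K \<rightarrow> K" using conj_class_conj[OF g] x(1) by blast
      show "(\<lambda>v. inv x \<otimes> v \<otimes> x) \<in> K \<rightarrow> K"
      proof (intro funcsetI)
        fix v assume v: "v \<in> K"
        have "inv x \<otimes> v \<otimes> inv (inv x) \<in> K" by (rule conj_class_conj[OF g v]) (use x(1) in simp)
        thus "inv x \<otimes> v \<otimes> x \<in> K" using x(1) by simp
      qed
    qed (use x(1) Kc in \<open>auto simp: m_assoc inv_mult_cancel\<close>)
    have "h w = (\<Sum>v\<in>K. cind_pow k (inv w \<otimes> inv (x \<otimes> v \<otimes> inv x)))"
      unfolding h_def by (rule sum.reindex_bij_betw[OF bK, symmetric])
    also have "\<dots> = (\<Sum>v\<in>K. cind_pow k (inv g \<otimes> inv v))"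
    proof (intro sum.cong refl)
      fix v assume v: "v \<in> K"
      have "inv w \<otimes> inv (x \<otimes> v \<otimes> inv x) = x \<otimes> (inv g \<otimes> inv v) \<otimes> inv x"
        using x g Kc[OF v] by (simp add: m_assoc inv_mult_group inv_mult_cancel)
      thus "cind_pow k (inv w \<otimes> inv (x \<otimes> v \<otimes> inv x)) = cind_pow k (inv g \<otimes> inv v)"
        using class_fun_conj[OF class_fun_cind_pow, of "inv g \<otimes> inv v" x k] x g Kc[OF v] by simp
    qed
    finally show ?thesis by (simp add: h_def)
  qed
  have "cind_pow (k + 2) \<one> = (\<Sum>w\<in>carrier G. h w * cind w)"
  proof -
    have "cind_pow (k + 2) \<one> = (\<Sum>w\<in>carrier G. conv (cind_pow k) cind (\<one> \<otimes> inv w) * cind w)"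
      unfolding add_2_eq_Suc' cind_pow_Suc by (subst conv_def) (rule refl)
    also have "\<dots> = (\<Sum>w\<in>carrier G. h w * cind w)"
      by (intro sum.cong refl) (simp add: conv1)
    finally show ?thesis .
  qed
  also have "\<dots> = (\<Sum>w\<in>K. h w)" unfolding sum_mult_cind by (simp add: sumh)
  also have "\<dots> = q * h g" using h_class by simp
  finally have 1: "cind_pow (k + 2) \<one> = q * h g" .
  have "(\<Sum>z\<in>carrier G. cind_pow k (z \<otimes> inv (g \<otimes> z \<otimes> g)))
      = (\<Sum>z\<in>carrier G. cind_pow k (inv g \<otimes> inv (z \<otimes> g \<otimes> inv z)))"
  proof (intro sum.cong refl)
    fix z assume z: "z \<in> carrier G"
    have "cind_pow k (z \<otimes> inv (g \<otimes> z \<otimes> g)) = cind_pow k ((z \<otimes> inv g \<otimes> inv z) \<otimes> inv g)"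
      using z g by (simp add: m_assoc inv_mult_group)
    also have "\<dots> = cind_pow k (inv g \<otimes> (z \<otimes> inv g \<otimes> inv z))"
      by (rule class_funD[OF class_fun_cind_pow]) (use z g in auto)
    finally show "cind_pow k (z \<otimes> inv (g \<otimes> z \<otimes> g)) = cind_pow k (inv g \<otimes> inv (z \<otimes> g \<otimes> inv z))"
      using z g by (simp add: m_assoc inv_mult_group)
  qed
  also have "\<dots> = of_nat (card (centralizer_of g)) * h g"
    unfolding h_def by (rule sum_over_conjugates[OF fin g])
  also have "\<dots> = of_nat n * cind_pow (k + 2) \<one> / q ^ 2"
    unfolding 1 order_eq_centralizer_times_class[OF fin g] using q0 by (simp add: power2_eq_square)
  finally show ?thesis .
qed

end

context finite_group_class
begin

lemma ex_enumeration: "\<exists>b. bij_betw b {..<n} (carrier G)"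
  using ex_bij_betw_nat_finite[OF fin] by (simp add: Coset.order_def atLeast0LessThan)

context
  fixes b assumes b: "bij_betw b {..<n} (carrier G)"
begin

abbreviation cind_mat where "cind_mat \<equiv> fun_mat b n (\<lambda>x y. cind (x \<otimes> inv y))"
text \<open>The permutation matrix of multiplication by the same power of \<open>g\<close> on both
  sides; \<open>twist_mat 1\<close> plays the role of \<open>N\<close>.\<close>

abbreviation twist_mat where "twist_mat k \<equiv> fun_mat b n (\<lambda>x y. if x = g [^] (k::nat) \<otimes> y \<otimes> g [^] k then 1 else 0)"

lemma cind_mat_pow: "cind_mat ^\<^sub>m k = fun_mat b n (\<lambda>x y. cind_pow k (x \<otimes> inv y))"
proof (induction k)
  case 0
  have "x \<otimes> inv y = \<one> \<longleftrightarrow> x = y" if "x \<in> carrier G" "y \<in> carrier G" for x y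
    using that inv_equality[of x "inv y"] by auto
  hence "1\<^sub>m n = fun_mat b n (\<lambda>x y. cind_pow 0 (x \<otimes> inv y))"
    unfolding one_mat_fun_mat[OF b] by (intro fun_mat_cong[OF b]) (auto simp: cind_pow_def)
  thus ?case by (simp add: fun_mat_def)
next
  case (Suc k)
  thus ?case by (simp add: cind_pow_Suc fun_mat_convolution[OF b])
qed

lemma mtrace_cind_mat_pow: "mtrace (cind_mat ^\<^sub>m k) = of_nat n * cind_pow k \<one>"
  unfolding cind_mat_pow mtrace_fun_mat[OF b] by (simp add: Coset.order_def)

lemma twist_mat_pow: "twist_mat 1 ^\<^sub>m k = twist_mat k"
proof (induction k)
  case 0
  have "1\<^sub>m n = twist_mat 0"
    unfolding one_mat_fun_mat[OF b] by (rule fun_mat_cong[OF b]) auto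
  moreover have "dim_row (twist_mat 1) = n" by (simp add: fun_mat_def)
  ultimately show ?case by (simp only: pow_mat.simps)
next
  case (Suc k)
  have "twist_mat 1 ^\<^sub>m Suc k = twist_mat k * twist_mat 1" by (simp only: pow_mat.simps Suc)
  also have "\<dots> = twist_mat (Suc k)"
    unfolding fun_mat_mult[OF b]
  proof (rule fun_mat_cong[OF b])
    fix x y assume xy: "x \<in> carrier G" "y \<in> carrier G"
    have gk: "g [^] Suc k = g \<otimes> g [^] k" by (rule nat_pow_Suc2[OF g])
    have eq: "g [^] k \<otimes> (g [^] (1::nat) \<otimes> y \<otimes> g [^] (1::nat)) \<otimes> g [^] k = g [^] Suc k \<otimes> y \<otimes> g [^] Suc k"
      using xy g by (subst (2) gk) (simp add: m_assoc)
    have "(\<Sum>z\<in>carrier G. (if x = g [^] k \<otimes> z \<otimes> g [^] k then 1 else 0)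
          * (if z = g [^] (1::nat) \<otimes> y \<otimes> g [^] (1::nat) then 1 else 0))
        = (\<Sum>z\<in>carrier G. if z = g [^] (1::nat) \<otimes> y \<otimes> g [^] (1::nat)
            then (if x = g [^] k \<otimes> z \<otimes> g [^] k then 1 else 0) else 0 :: complex)"
      by (intro sum.cong) auto
    also have "\<dots> = (if x = g [^] k \<otimes> (g [^] (1::nat) \<otimes> y \<otimes> g [^] (1::nat)) \<otimes> g [^] k then 1 else 0)"
      using fin xy g by (simp add: sum.delta)
    finally show "(\<Sum>z\<in>carrier G. (if x = g [^] k \<otimes> z \<otimes> g [^] k then 1 else 0)
          * (if z = g [^] (1::nat) \<otimes> y \<otimes> g [^] (1::nat) then 1 else 0))
        = (if x = g [^] Suc k \<otimes> y \<otimes> g [^] Suc k then 1 else 0 :: complex)" unfolding eq .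
  qed
  finally show ?case .
qed

lemma twist_mat_mult:
  "twist_mat 1 * fun_mat b n F = fun_mat b n (\<lambda>x y. F (inv g \<otimes> x \<otimes> inv g) y)"
  unfolding fun_mat_mult[OF b]
proof (rule fun_mat_cong[OF b])
  fix x y assume xy: "x \<in> carrier G" "y \<in> carrier G"
  have iff: "x = g [^] (1::nat) \<otimes> z \<otimes> g [^] (1::nat) \<longleftrightarrow> z = inv g \<otimes> x \<otimes> inv g"
    if z: "z \<in> carrier G" for z
    using z xy g by (auto simp: m_assoc inv_mult_cancel)
  have "(\<Sum>z\<in>carrier G. (if x = g [^] (1::nat) \<otimes> z \<otimes> g [^] (1::nat) then 1 else 0) * F z y)
      = (\<Sum>z\<in>carrier G. if z = inv g \<otimes> x \<otimes> inv g then F z y else 0)"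
    by (intro sum.cong refl) (simp only: iff, simp)
  also have "\<dots> = F (inv g \<otimes> x \<otimes> inv g) y"
    using fin xy g by (simp add: sum.delta)
  finally show "(\<Sum>z\<in>carrier G. (if x = g [^] (1::nat) \<otimes> z \<otimes> g [^] (1::nat) then 1 else 0) * F z y)
      = F (inv g \<otimes> x \<otimes> inv g) y" .
qed

lemma mult_twist_mat:
  "fun_mat b n F * twist_mat 1 = fun_mat b n (\<lambda>x y. F x (g \<otimes> y \<otimes> g))"
  unfolding fun_mat_mult[OF b]
proof (rule fun_mat_cong[OF b])
  fix x y assume xy: "x \<in> carrier G" "y \<in> carrier G"
  have "(\<Sum>z\<in>carrier G. F x z * (if z = g [^] (1::nat) \<otimes> y \<otimes> g [^] (1::nat) then 1 else 0))
      = (\<Sum>z\<in>carrier G. if z = g \<otimes> y \<otimes> g then F x z else 0)"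
    using g by (intro sum.cong refl) auto
  also have "\<dots> = F x (g \<otimes> y \<otimes> g)"
    using fin xy g by (simp add: sum.delta)
  finally show "(\<Sum>z\<in>carrier G. F x z * (if z = g [^] (1::nat) \<otimes> y \<otimes> g [^] (1::nat) then 1 else 0))
      = F x (g \<otimes> y \<otimes> g)" .
qed

text \<open>Both products evaluate \<open>cind\<close> at cyclic permutations of one product of
  \<open>inv g\<close>, \<open>x\<close>, \<open>inv g\<close> and \<open>inv y\<close>, which a
  class function does not distinguish.\<close>

lemma twist_mat_cind_mat_commute: "twist_mat 1 * cind_mat = cind_mat * twist_mat 1"
  unfolding twist_mat_mult mult_twist_mat
proof (rule fun_mat_cong[OF b])
  fix x y assume xy: "x \<in> carrier G" "y \<in> carrier G"
  have "cind (inv g \<otimes> (x \<otimes> inv g \<otimes> inv y)) = cind ((x \<otimes> inv g \<otimes> inv y) \<otimes> inv g)"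
    by (rule class_funD[OF class_fun_cind]) (use xy g in auto)
  thus "cind (inv g \<otimes> x \<otimes> inv g \<otimes> inv y) = cind (x \<otimes> inv (g \<otimes> y \<otimes> g))"
    using xy g by (simp add: m_assoc inv_mult_group)
qed

lemma twist_mat_order: "twist_mat 1 ^\<^sub>m n = 1\<^sub>m n"
  unfolding twist_mat_pow one_mat_fun_mat[OF b]
  by (rule fun_mat_cong[OF b]) (use pow_order_eq_1[OF g] in auto)

lemma mtrace_twist_mat_cind_mat_pow:
  assumes "k \<ge> 1"
  shows "mtrace (twist_mat 1 * cind_mat ^\<^sub>m k) = mtrace (cind_mat ^\<^sub>m (k + 2)) / q ^ 2"
proof -
  have "mtrace (twist_mat 1 * cind_mat ^\<^sub>m k) = mtrace (cind_mat ^\<^sub>m k * twist_mat 1)"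
    by (rule mtrace_mult_commute[of _ n]) (auto simp: cind_mat_pow)
  also have "\<dots> = of_nat n * cind_pow (k + 2) \<one> / q ^ 2"
    unfolding cind_mat_pow mult_twist_mat mtrace_fun_mat[OF b] by (rule cind_pow_trace[OF assms])
  finally show ?thesis unfolding mtrace_cind_mat_pow .
qed

lemma mtrace_cind_mat: "mtrace (cind_mat ^\<^sub>m 1) = - q"
proof -
  have "mtrace cind_mat = of_nat n * cind \<one>"
    unfolding mtrace_fun_mat[OF b] by (simp add: Coset.order_def)
  thus ?thesis using one_notin_K n_ge_2 by (simp add: cind_def fun_mat_def)
qed

lemma sum_K_translate:
  assumes "x \<in> carrier G"
  shows "(\<Sum>y\<in>carrier G. (if x \<otimes> inv y \<in> K then 1 else 0) * f y) = (\<Sum>v\<in>K. f (inv v \<otimes> x) :: complex)"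
proof -
  have "(\<Sum>y\<in>carrier G. (if x \<otimes> inv y \<in> K then 1 else 0) * f y)
      = (\<Sum>y\<in>carrier G. (\<lambda>v. if v \<in> K then f (inv v \<otimes> x) else 0) (x \<otimes> inv y))"
    using assms by (intro sum.cong) (auto simp: inv_mult_group m_assoc)
  also have "\<dots> = (\<Sum>v\<in>carrier G. if v \<in> K then f (inv v \<otimes> x) else 0)"
    by (rule sum.reindex_bij_betw[OF bij_betw_trans[OF bij_inv bij_mult_left[OF assms], unfolded o_def]])
  finally show ?thesis by (simp only: sum_K)
qed

text \<open>The columns of the matrix sum to zero, so an eigenfunction for a nonzero eigenvalue has
  sum zero. On such functions the constant in \<open>cind\<close> has no effect, and the operator is
  the uncorrected class sum.\<close>

lemma eigenvalue_cind_mat: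
  assumes ev: "eigenvalue cind_mat e" and e0: "e \<noteq> 0"
  obtains f x0 where "x0 \<in> carrier G" "f x0 \<noteq> 0" "(\<Sum>x\<in>carrier G. f x) = 0"
    "\<And>x. x \<in> carrier G \<Longrightarrow> (\<Sum>v\<in>K. f (inv v \<otimes> x)) = e * f x"
proof -
  obtain f x0 where x0: "x0 \<in> carrier G" "f x0 \<noteq> 0"
    and f: "\<And>x. x \<in> carrier G \<Longrightarrow> (\<Sum>y\<in>carrier G. cind (x \<otimes> inv y) * f y) = e * f x"
    using eigenvalue_fun_mat[OF b ev] by metis
  have "e * (\<Sum>x\<in>carrier G. f x) = (\<Sum>x\<in>carrier G. \<Sum>y\<in>carrier G. cind (x \<otimes> inv y) * f y)"
    by (simp add: f sum_distrib_left)
  also have "\<dots> = (\<Sum>y\<in>carrier G. (\<Sum>x\<in>carrier G. cind (x \<otimes> inv y)) * f y)"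
    by (subst sum.swap) (simp add: sum_distrib_right)
  also have "\<dots> = (\<Sum>y\<in>carrier G. (\<Sum>x\<in>carrier G. cind x) * f y)"
    by (intro sum.cong refl arg_cong2[where f = "(*)"] sum.reindex_bij_betw bij_mult_right) auto
  finally have sf: "(\<Sum>x\<in>carrier G. f x) = 0" using e0 by (simp add: sum_cind)
  have "(\<Sum>v\<in>K. f (inv v \<otimes> x)) = e * f x" if x: "x \<in> carrier G" for x
  proof -
    have "e * f x = (\<Sum>y\<in>carrier G. (if x \<otimes> inv y \<in> K then 1 else 0) * f y - q / of_nat n * f y)"
      unfolding f[OF x, symmetric] by (intro sum.cong) (auto simp: cind_def algebra_simps)
    also have "\<dots> = (\<Sum>v\<in>K. f (inv v \<otimes> x))"
      by (simp only: sum_subtractf sum_K_translate[OF x] sum_distrib_left[symmetric] sf) simp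
    finally show ?thesis by simp
  qed
  thus ?thesis using that x0 sf by blast
qed

text \<open>At a point where \<open>f\<close> has maximal absolute value, the sum has
  \<open>card K\<close> terms, none of which exceeds that maximum.\<close>

lemma norm_eigenvalue_le:
  assumes x0: "x0 \<in> carrier G" "f x0 \<noteq> (0::complex)"
    and f: "\<And>x. x \<in> carrier G \<Longrightarrow> (\<Sum>v\<in>K. f (inv v \<otimes> x)) = e * f x"
  shows "norm e \<le> card K"
proof -
  obtain x where x: "x \<in> carrier G" "\<And>y. y \<in> carrier G \<Longrightarrow> norm (f y) \<le> norm (f x)"
    using fin x0(1) obtains_MAX[of "carrier G" "\<lambda>y. norm (f y)"]
    by (metis (no_types, lifting) Max_ge empty_iff finite_imageI imageI)
  have "norm e * norm (f x) = norm (\<Sum>v\<in>K. f (inv v \<otimes> x))" by (simp add: f[OF x(1)] norm_mult)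
  also have "\<dots> \<le> (\<Sum>v\<in>K. norm (f x))"
    by (rule sum_norm_le) (use x K(1) in auto)
  finally have "norm e * norm (f x) \<le> card K * norm (f x)" by simp
  moreover have "norm (f x) > 0" using x(2)[OF x0(1)] x0(2) by (meson norm_le_zero_iff not_le order_trans)
  ultimately show ?thesis by simp
qed

text \<open>\<open>e\<close> is an eigenvalue of a rational matrix with entries 0 and 1, so every
  conjugate of \<open>e / q\<close> is an eigenvalue of the same matrix divided by \<open>q\<close>,
  which \<open>norm_eigenvalue_le\<close> bounds by 1.\<close>

lemma norm_1_if_algebraic_int:
  assumes x0: "x0 \<in> carrier G" "f x0 \<noteq> (0::complex)"
    and f: "\<And>x. x \<in> carrier G \<Longrightarrow> (\<Sum>v\<in>K. f (inv v \<otimes> x)) = e * f x"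
    and e0: "e \<noteq> 0" and int: "algebraic_int (e / q)"
  shows "norm (e / q) = 1"
proof -
  define Mr :: "rat mat" where "Mr = mat n n (\<lambda>(i,j). if b i \<otimes> inv (b j) \<in> K then 1 else 0)"
  have Mr: "Mr \<in> carrier_mat n n" by (simp add: Mr_def)
  define F where "F = (\<lambda>x y. if x \<otimes> inv y \<in> K then 1 else 0 :: complex)"
  have MrF: "map_mat of_rat Mr = fun_mat b n F"
    by (auto simp: Mr_def fun_mat_def F_def intro!: eq_matI)
  \<comment> \<open>Replacing the variable by \<open>card K\<close> times the variable turns the
    roots of the characteristic polynomial into eigenvalues divided by \<open>q\<close>.\<close>
  define c where "c = pcompose (char_poly Mr) [:0, of_nat (card K):]"
  have "map_poly of_rat [:0, of_nat (card K) :: rat:] = [:0, q:]"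
    by (simp add: of_rat_hom.map_poly_pCons_hom)
  hence "map_poly of_rat c = pcompose (char_poly (fun_mat b n F)) [:0, q:]"
    unfolding c_def MrF[symmetric] of_rat_hom.char_poly_hom[OF Mr] by (simp add: of_rat_hom.map_poly_pcompose)
  hence c: "poly (map_poly of_rat c) z = 0 \<longleftrightarrow> eigenvalue (fun_mat b n F) (z * q)" for z
    by (simp add: poly_pcompose eigenvalue_root_char_poly[OF fun_mat_carrier])
  show ?thesis
  proof (rule norm_eq_1_if_conjugates_bounded[OF int, of c])
    have "eigenvalue (fun_mat b n F) e"
      by (rule eigenvalue_fun_matI[where f = f, OF b x0]) (use f sum_K_translate in \<open>simp add: F_def\<close>)
    thus "poly (map_poly of_rat c) (e / q) = 0" using c[of "e / q"] q0 by simp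
    fix z :: complex assume "poly (map_poly of_rat c) z = 0"
    hence "eigenvalue (fun_mat b n F) (z * q)" by (simp add: c)
    then obtain h y0 where h: "y0 \<in> carrier G" "h y0 \<noteq> 0"
      "\<And>x. x \<in> carrier G \<Longrightarrow> (\<Sum>y\<in>carrier G. F x y * h y) = (z * q) * h x"
      using eigenvalue_fun_mat[OF b] by metis
    have "norm (z * q) \<le> card K"
      by (rule norm_eigenvalue_le[where f = h, OF h(1,2)]) (use h(3) sum_K_translate in \<open>simp add: F_def\<close>)
    thus "norm z \<le> 1" using q0 by (simp add: norm_mult)
  qed (use e0 q0 in auto)
qed

lemma algebraic_int_eigenvalue:
  assumes x0: "x0 \<in> carrier G" "f x0 \<noteq> (0::complex)"
    and f: "\<And>x. x \<in> carrier G \<Longrightarrow> (\<Sum>v\<in>K. f (inv v \<otimes> x)) = e * f x"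
  shows "algebraic_int e"
proof (rule algebraic_int_of_int_system[where v = f and B = "\<lambda>x y. if x \<otimes> inv y \<in> K then 1 else 0", OF fin x0])
  fix x assume x: "x \<in> carrier G"
  have "e * f x = (\<Sum>y\<in>carrier G. (if x \<otimes> inv y \<in> K then 1 else 0) * f y)"
    unfolding sum_K_translate[OF x] f[OF x] ..
  also have "\<dots> = (\<Sum>y\<in>carrier G. of_int (if x \<otimes> inv y \<in> K then 1 else 0) * f y)"
    by (intro sum.cong) auto
  finally show "e * f x = (\<Sum>y\<in>carrier G. of_int (if x \<otimes> inv y \<in> K then 1 else 0) * f y)" .
qed

text \<open>The maximum principle. Equality at a point of maximal absolute value forces all terms of
  the sum over \<open>K\<close> to agree, so the set of maxima is invariant under \<open>K\<close>,
  which generates the group. Then \<open>f\<close> is invariant under the quotients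
  \<open>inv v \<otimes> w\<close> of elements of \<open>K\<close>; these generate the group too, so
  \<open>f\<close> is constant, against its sum being zero.\<close>

lemma norm_eigenvalue_less:
  assumes simple: "simple_group G" and K1: "card K > 1"
    and x0: "x0 \<in> carrier G" "f x0 \<noteq> (0::complex)" and sf: "(\<Sum>x\<in>carrier G. f x) = 0"
    and f: "\<And>x. x \<in> carrier G \<Longrightarrow> (\<Sum>v\<in>K. f (inv v \<otimes> x)) = e * f x"
  shows "norm (e / q) \<noteq> 1"
proof
  assume norm1: "norm (e / q) = 1"
  have Kc: "v \<in> carrier G" if "v \<in> K" for v using K that by blast
  have normal_gen: "generate G S = carrier G"
    if "S \<subseteq> carrier G" "\<And>h y. h \<in> S \<Longrightarrow> y \<in> carrier G \<Longrightarrow> y \<otimes> h \<otimes> inv y \<in> S" "s \<in> S" "s \<noteq> \<one>" for S s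
  proof -
    have "generate G S \<lhd> G" using normal_generateI that(1,2) by blast
    moreover have "s \<in> generate G S" using that(3) by (rule generate.incl)
    ultimately show ?thesis using simple_group.no_real_normal_subgroup[OF simple] that(4) by blast
  qed
  define B where "B = Max ((\<lambda>y. norm (f y)) ` carrier G)"
  have B_ge: "norm (f y) \<le> B" if "y \<in> carrier G" for y
    unfolding B_def using fin that by (intro Max_ge) auto
  define D where "D = {x \<in> carrier G. norm (f x) = B}"
  have "B \<in> (\<lambda>y. norm (f y)) ` carrier G"
    unfolding B_def using fin x0(1) by (intro Max_in) auto
  then obtain x1 where x1: "x1 \<in> D" by (auto simp: D_def)
  \<comment> \<open>The \<open>card K\<close> terms have average \<open>e / q * f x\<close>, whose
    absolute value is the maximum \<open>B\<close>; hence each term equals the average.\<close>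
  have step: "f (inv v \<otimes> x) = e / q * f x" if "x \<in> D" "v \<in> K" for x v
  proof (rule sum_eq_bound_imp_eq[OF K(2) that(2)])
    have x: "x \<in> carrier G" "norm (f x) = B" using that by (auto simp: D_def)
    fix w assume "w \<in> K"
    thus "norm (f (inv w \<otimes> x)) \<le> norm (e / q * f x)"
      using B_ge x Kc norm1 by (simp only: norm_mult) simp
  next
    show "(\<Sum>t\<in>K. f (inv t \<otimes> x)) = q * (e / q * f x)"
      using f that q0 by (simp add: D_def)
  qed
  \<comment> \<open>The stabilizer of the set of maxima under left multiplication; it will be shown
    to contain \<open>K\<close>.\<close>
  define U where "U = {h \<in> carrier G. \<forall>x\<in>D. h \<otimes> x \<in> D}"
  have U: "subgroup U G"
  proof (rule subgroup_of_finite_mult_closed[OF fin])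
    have "\<one> \<in> U" by (auto simp: U_def D_def)
    thus "U \<noteq> {}" by blast
    fix h k assume hk: "h \<in> U" "k \<in> U"
    have "h \<otimes> k \<otimes> x \<in> D" if x: "x \<in> D" for x
    proof -
      have "h \<otimes> (k \<otimes> x) \<in> D" using hk x by (auto simp: U_def)
      thus ?thesis using hk x by (simp add: U_def D_def m_assoc)
    qed
    thus "h \<otimes> k \<in> U" using hk by (simp add: U_def)
  qed (auto simp: U_def)
  have "v \<in> U" if v: "v \<in> K" for v
  proof -
    have "inv v \<otimes> x \<in> D" if x: "x \<in> D" for x
    proof -
      have "norm (f (inv v \<otimes> x)) = norm (e / q) * norm (f x)" by (simp only: step[OF x v] norm_mult)
      thus ?thesis using norm1 x Kc[OF v] by (simp add: D_def)
    qed
    hence "inv v \<in> U" using Kc[OF v] by (simp add: U_def)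
    hence "inv (inv v) \<in> U" using subgroup.m_inv_closed[OF U] by blast
    thus ?thesis using Kc[OF v] by simp
  qed
  hence "generate G K \<subseteq> U" using generate_subgroup_incl[OF _ U] by blast
  moreover have "generate G K = carrier G"
    by (rule normal_gen[OF K(1) _ conj_class_self[OF g] g1]) (use conj_class_conj[OF g] in auto)
  ultimately have UG: "U = carrier G" by (auto simp: U_def)
  have DG: "x \<in> D" if x: "x \<in> carrier G" for x
  proof -
    have "x \<otimes> inv x1 \<in> U" using UG x x1 by (auto simp: D_def)
    hence "x \<otimes> inv x1 \<otimes> x1 \<in> D" using x1 by (auto simp: U_def)
    thus ?thesis using x x1 by (simp add: D_def m_assoc)
  qed
  define T where "T = {h \<in> carrier G. \<forall>x\<in>carrier G. f (h \<otimes> x) = f x}"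
  have T: "subgroup T G"
    by (rule subgroup_of_finite_mult_closed[OF fin]) (auto simp: T_def m_assoc)
  \<comment> \<open>The factor \<open>e / q\<close> is the same for all elements of
    \<open>K\<close>, so it cancels in these quotients and they fix \<open>f\<close>. Two distinct
    elements of \<open>K\<close> provide a quotient other than the identity.\<close>
  define S where "S = {inv v \<otimes> w | v w. v \<in> K \<and> w \<in> K}"
  have S: "S \<subseteq> carrier G" using Kc by (auto simp: S_def)
  have ST: "S \<subseteq> T"
  proof
    fix s assume "s \<in> S"
    then obtain v w where vw: "s = inv v \<otimes> w" "v \<in> K" "w \<in> K" by (auto simp: S_def)
    have "f (s \<otimes> x) = f x" if x: "x \<in> carrier G" for x
    proof -
      have wx: "w \<otimes> x \<in> D" using Kc[OF vw(3)] x DG by simp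
      have "f (s \<otimes> x) = f (inv v \<otimes> (w \<otimes> x))" using Kc vw x by (simp add: m_assoc)
      also have "\<dots> = f (inv w \<otimes> (w \<otimes> x))" using step[OF wx] vw by simp
      finally show ?thesis using Kc[OF vw(3)] x by (simp add: inv_mult_cancel)
    qed
    thus "s \<in> T" using vw Kc by (simp add: T_def)
  qed
  have Sconj: "y \<otimes> s \<otimes> inv y \<in> S" if s: "s \<in> S" and y: "y \<in> carrier G" for s y
  proof -
    obtain v w where vw: "s = inv v \<otimes> w" "v \<in> K" "w \<in> K" using s by (auto simp: S_def)
    have "y \<otimes> s \<otimes> inv y = inv (y \<otimes> v \<otimes> inv y) \<otimes> (y \<otimes> w \<otimes> inv y)"
      using vw Kc y by (simp add: m_assoc inv_mult_group inv_mult_cancel)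
    thus ?thesis using conj_class_conj[OF g _ y] vw unfolding S_def by blast
  qed
  obtain v w where vw: "v \<in> K" "w \<in> K" "v \<noteq> w"
    using K1 by (metis card_le_Suc0_iff_eq K(2) One_nat_def not_le)
  have "inv v \<otimes> w \<noteq> \<one>"
    using vw Kc by (metis inv_closed inv_equality inv_inv l_inv r_inv inv_comm)
  hence "generate G S = carrier G"
    by (intro normal_gen[OF S Sconj, of "inv v \<otimes> w"]) (use vw in \<open>auto simp: S_def\<close>)
  hence TG: "T = carrier G" using generate_subgroup_incl[OF ST T] by (auto simp: T_def)
  have const: "f x = f \<one>" if x: "x \<in> carrier G" for x
  proof -
    have "x \<in> T" using x TG by simp
    hence "f (x \<otimes> \<one>) = f \<one>" unfolding T_def by blast
    thus ?thesis using x by simp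
  qed
  have "(\<Sum>x\<in>carrier G. f x) = (\<Sum>x\<in>carrier G. f x0)"
    by (intro sum.cong refl) (use const x0(1) in \<open>metis\<close>)
  hence "(\<Sum>x\<in>carrier G. f x) = of_nat n * f x0" by (simp add: Coset.order_def)
  thus False using sf x0 n_ge_2 by simp
qed

end

lemma simple_group_class_not_prime_power:
  assumes simple: "simple_group G" and p: "Factorial_Ring.prime p"
    and card_K: "card K = p ^ a" "card K > 1"
  shows False
proof -
  obtain b where b: "bij_betw b {..<n} (carrier G)" using ex_enumeration by blast
  let ?M = "fun_mat b n (\<lambda>x y. cind (x \<otimes> inv y))"
  obtain es where es: "char_poly ?M = (\<Prod>a\<leftarrow>es. [:- a, 1:])"
    "\<And>k. mtrace (?M ^\<^sub>m k) = (\<Sum>e\<leftarrow>es. e ^ k)"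
    using mtrace_pow_eq_power_sum[OF fun_mat_carrier] by blast
  define E where "E = set es - {0}"
  have mult_int: "algebraic_int (of_nat (count_list es z) * (z / q) ^ 2)" if "z \<noteq> 0" for z
    by (rule algebraic_int_multiplicity_times_square[OF fun_mat_carrier fun_mat_carrier
          twist_mat_cind_mat_commute[OF b] twist_mat_order[OF b] n_ge_2 mtrace_twist_mat_cind_mat_pow[OF b] es(2) that])
  have rad: "of_nat (count_list es z) * (z / q) \<in> alg_int_rad p" if z: "z \<in> E" for z
  proof -
    let ?d = "count_list es z"
    have z0: "z \<noteq> 0" using z by (simp add: E_def)
    have "poly (char_poly ?M) z = 0"
      unfolding es(1) using z by (auto simp: E_def poly_prod_list prod_list_zero_iff o_def)
    hence "eigenvalue ?M z" using eigenvalue_root_char_poly[OF fun_mat_carrier] by blast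
    then obtain f x0 where x0: "x0 \<in> carrier G" "f x0 \<noteq> 0" and sf: "(\<Sum>x\<in>carrier G. f x) = 0"
      and f: "\<And>x. x \<in> carrier G \<Longrightarrow> (\<Sum>v\<in>K. f (inv v \<otimes> x)) = z * f x"
      using eigenvalue_cind_mat[OF b _ z0] by metis
    have "\<not> algebraic_int (z / q)"
      using norm_1_if_algebraic_int[OF b x0 f z0] norm_eigenvalue_less[OF b simple card_K(2) x0 sf f] by blast
    moreover have "algebraic_int (z / q)" if nd: "\<not> p dvd ?d"
    proof -
      \<comment> \<open>The square of \<open>card K\<close> is a power of \<open>p\<close>, so a
        Bezout relation with \<open>?d\<close> writes the square of \<open>z / q\<close> as an
        integer combination of two algebraic integers: \<open>?d\<close> times that square, and the
        square of \<open>z\<close>.\<close>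
      have "coprime (int ?d) (int ((card K)\<^sup>2))"
        unfolding card_K(1) using prime_imp_coprime[OF p nd]
        by (simp add: coprime_commute)
      then obtain u v where "u * int ?d + v * int ((card K)\<^sup>2) = 1"
        using bezout_int[of "int ?d" "int ((card K)\<^sup>2)"] by auto
      hence "(of_int (u * int ?d + v * int ((card K)\<^sup>2)) :: complex) = 1" by simp
      hence uv: "of_int u * of_nat ?d + of_int v * q\<^sup>2 = 1" by simp
      have "(z / q)\<^sup>2 = (of_int u * of_nat ?d + of_int v * q\<^sup>2) * (z / q)\<^sup>2" unfolding uv by simp
      also have "\<dots> = of_int u * (of_nat ?d * (z / q)\<^sup>2) + of_int v * z\<^sup>2"
        using q0 by (simp add: field_simps)
      finally have eq: "(z / q)\<^sup>2 = of_int u * (of_nat ?d * (z / q)\<^sup>2) + of_int v * z\<^sup>2" .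
      have z_int: "algebraic_int z" by (rule algebraic_int_eigenvalue[OF b x0 f])
      have "algebraic_int (of_int u * (of_nat ?d * (z / q)\<^sup>2) + of_int v * z\<^sup>2)"
        by (intro algebraic_int_add algebraic_int_mult[OF int_imp_algebraic_int[OF Ints_of_int]]
            mult_int[OF z0] algebraic_int_power z_int)
      hence "algebraic_int ((z / q)\<^sup>2)" by (subst eq)
      thus ?thesis by (rule algebraic_int_of_power) simp
    qed
    ultimately have "p dvd ?d" by blast
    then obtain c where c: "?d = p * c" by (elim dvdE)
    have p0: "p \<noteq> 0" using p by auto
    \<comment> \<open>Of the two factors \<open>?d\<close> in the square, one gives its divisor
      \<open>p\<close> to the denominator and the other stays with the square of
      \<open>z / q\<close>, where \<open>mult_int\<close> applies.\<close>
    have "(of_nat ?d * (z / q))\<^sup>2 / of_nat p = of_nat c * (of_nat ?d * (z / q)\<^sup>2)"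
      using p0 by (simp add: c power2_eq_square field_simps)
    hence 1: "algebraic_int ((of_nat ?d * (z / q))\<^sup>2 / of_nat p)"
      using algebraic_int_mult[OF int_imp_algebraic_int[OF Ints_of_nat] mult_int[OF z0]] by (simp only:)
    have "(of_nat ?d * (z / q))\<^sup>2 = of_nat ?d * (of_nat ?d * (z / q)\<^sup>2)"
      by (simp add: power2_eq_square)
    hence "algebraic_int ((of_nat ?d * (z / q))\<^sup>2)"
      using algebraic_int_mult[OF int_imp_algebraic_int[OF Ints_of_nat] mult_int[OF z0]] by (simp only:)
    hence "algebraic_int (of_nat ?d * (z / q))" by (rule algebraic_int_of_power) simp
    with 1 show ?thesis unfolding alg_int_rad_def by blast
  qed
  have p1: "p > 1" using p by (rule prime_gt_1_nat)
  \<comment> \<open>Zero eigenvalues do not contribute to the trace. It equals \<open>- q\<close>,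
    because the identity is outside \<open>K\<close> and each diagonal entry is just the subtracted
    constant.\<close>
  have "(\<Sum>z\<in>E. of_nat (count_list es z) * z) = (\<Sum>e\<leftarrow>es. e)"
    by (rule sum_list_eq_sum_count[symmetric]) (auto simp: E_def)
  also have "\<dots> = - q" using es(2)[of 1] mtrace_cind_mat[OF b] by simp
  finally have "(\<Sum>z\<in>E. of_nat (count_list es z) * (z / q)) = -1"
    using q0 by (simp add: sum_divide_distrib[symmetric] field_simps)
  moreover have "(\<Sum>z\<in>E. of_nat (count_list es z) * (z / q)) \<in> alg_int_rad p"
    using rad p1 by (intro alg_int_rad_sum) auto
  ultimately show False using minus_one_notin_alg_int_rad[OF p1] by simp
qed

end

section \<open>Groups whose Sylow subgroups for odd primes commute\<close>

lemma (in group) group_actionI: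
  assumes closed: "\<And>g x. g \<in> carrier G \<Longrightarrow> x \<in> E \<Longrightarrow> act g x \<in> E"
    and one: "\<And>x. x \<in> E \<Longrightarrow> act \<one> x = x"
    and mult: "\<And>g h x. g \<in> carrier G \<Longrightarrow> h \<in> carrier G \<Longrightarrow> x \<in> E \<Longrightarrow> act (g \<otimes> h) x = act g (act h x)"
  shows "group_action G E (\<lambda>g. restrict (act g) E)"
proof -
  have Bij: "restrict (act g) E \<in> Bij E" if g: "g \<in> carrier G" for g
  proof -
    have "bij_betw (restrict (act g) E) E E"
    proof (rule bij_betwI[where g = "act (inv g)"])
      show "act (inv g) (restrict (act g) E x) = x" if "x \<in> E" for x
        using that g mult[of "inv g" g x] one by simp
      show "restrict (act g) E (act (inv g) x) = x" if "x \<in> E" for x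
        using that g mult[of g "inv g" x] one closed by simp
    qed (use g closed in auto)
    thus ?thesis by (simp add: Bij_def)
  qed
  have "(\<lambda>g. restrict (act g) E) \<in> hom G (BijGroup E)"
  proof (rule homI)
    fix g h assume gh: "g \<in> carrier G" "h \<in> carrier G"
    show "restrict (act (g \<otimes> h)) E = restrict (act g) E \<otimes>\<^bsub>BijGroup E\<^esub> restrict (act h) E"
      using gh Bij[OF gh(1)] Bij[OF gh(2)] mult closed
      by (auto simp: BijGroup_def compose_def restrict_def fun_eq_iff)
  qed (use Bij in \<open>auto simp: BijGroup_def\<close>)
  thus ?thesis
    unfolding group_action_def group_hom_def group_hom_axioms_def
    using group_BijGroup is_group by blast
qed

text \<open>The points that are moved form a union of orbits. Each such orbit has
  \<open>p\<close>-power size by the orbit-stabilizer theorem and more than one element.\<close>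

lemma (in group) p_group_dvd_card_nonfixed:
  assumes ord: "Coset.order G = p ^ k" and p: "Factorial_Ring.prime (p :: nat)" and fin: "finite E"
    and closed: "\<And>g x. g \<in> carrier G \<Longrightarrow> x \<in> E \<Longrightarrow> act g x \<in> E"
    and one: "\<And>x. x \<in> E \<Longrightarrow> act \<one> x = x"
    and mult: "\<And>g h x. g \<in> carrier G \<Longrightarrow> h \<in> carrier G \<Longrightarrow> x \<in> E \<Longrightarrow> act (g \<otimes> h) x = act g (act h x)"
  shows "p dvd card {x \<in> E. \<exists>g\<in>carrier G. act g x \<noteq> x}"
proof -
  let ?\<phi> = "\<lambda>g. restrict (act g) E"
  let ?M = "{x \<in> E. \<exists>g\<in>carrier G. act g x \<noteq> x}"
  interpret group_action G E ?\<phi> by (rule group_actionI[OF closed one mult])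
  let ?C = "orbit G ?\<phi> ` ?M"
  have orb: "orbit G ?\<phi> x = {act g x | g. g \<in> carrier G}" if "x \<in> E" for x
    using that by (auto simp: orbit_def)
  have self: "x \<in> orbit G ?\<phi> x" if "x \<in> E" for x using orbit_refl that by blast
  have sub: "orbit G ?\<phi> x \<subseteq> ?M" if x: "x \<in> ?M" for x
  proof
    fix y assume y: "y \<in> orbit G ?\<phi> x"
    have xE: "x \<in> E" using x by simp
    have yE: "y \<in> E" using y orb[OF xE] closed xE by auto
    have "x \<in> orbit G ?\<phi> y" using orbit_sym[OF xE yE y] .
    then obtain g where g: "g \<in> carrier G" "act g y = x" using orb[OF yE] by auto
    show "y \<in> ?M"
    proof (rule ccontr)
      assume "y \<notin> ?M"
      hence fixed: "\<And>h. h \<in> carrier G \<Longrightarrow> act h y = y" using yE by blast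
      hence "x = y" using g by simp
      thus False using x fixed by auto
    qed
  qed
  have Un: "\<Union>?C = ?M" using sub self by blast
  have "p dvd card (\<Union>?C)"
  proof (rule dvd_partition)
    show "finite (\<Union>?C)" unfolding Un using fin by simp
    show "\<forall>c\<in>?C. p dvd card c"
    proof
      fix c assume "c \<in> ?C"
      then obtain x where x: "x \<in> ?M" "c = orbit G ?\<phi> x" by blast
      have xE: "x \<in> E" using x by simp
      have "card c dvd p ^ k"
        using orbit_stabilizer_theorem[OF xE] unfolding x(2) ord by (metis dvd_triv_left)
      then obtain i where i: "card c = p ^ i" using divides_primepow_nat[OF p] by blast
      have "card c \<noteq> 1"
      proof
        assume "card c = 1"
        then obtain y where "c = {y}" by (auto simp: card_1_singleton_iff)
        hence "c = {x}" using self[OF xE] x(2) by auto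
        thus False using x(1) x(2) orb[OF xE] by auto
      qed
      thus "p dvd card c" using i by (cases i) auto
    qed
    show "\<forall>c1\<in>?C. \<forall>c2\<in>?C. c1 \<noteq> c2 \<longrightarrow> c1 \<inter> c2 = {}"
      using disjoint_union unfolding orbits_def by blast
  qed
  thus ?thesis unfolding Un .
qed

text \<open>The fixed points of conjugation are the central elements. Their number is divisible by
  \<open>p\<close>, and positive because of the identity.\<close>

lemma (in group) p_group_center_nontrivial:
  assumes ord: "Coset.order G = p ^ k" and p: "Factorial_Ring.prime (p :: nat)" and k: "k > 0"
  obtains z where "z \<in> carrier G" "z \<noteq> \<one>" "\<And>g. g \<in> carrier G \<Longrightarrow> g \<otimes> z = z \<otimes> g"
proof -
  have p0: "p > 0" using p by (rule prime_gt_0_nat)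
  have fin: "finite (carrier G)" using ord p0 order_gt_0_iff_finite by simp
  let ?M = "{x \<in> carrier G. \<exists>g\<in>carrier G. g \<otimes> x \<otimes> inv g \<noteq> x}"
  have "p dvd card ?M"
    by (rule p_group_dvd_card_nonfixed[OF ord p fin]) (auto simp: m_assoc inv_mult_group)
  moreover have "card (carrier G) = card ?M + card (carrier G - ?M)"
    using fin by (subst card_Un_disjoint[symmetric]) (auto intro: arg_cong[where f = card])
  moreover have "p dvd card (carrier G)" using ord k by (simp add: Coset.order_def)
  ultimately have "p dvd card (carrier G - ?M)" by (simp add: dvd_add_right_iff)
  moreover have "\<one> \<in> carrier G - ?M" by auto
  hence "card (carrier G - ?M) > 0" using fin by (auto simp: card_gt_0_iff)
  ultimately have "card (carrier G - ?M) \<ge> p" by (intro dvd_imp_le)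
  hence "card (carrier G - ?M) > 1" using prime_gt_1_nat[OF p] by simp
  hence "\<not> carrier G - ?M \<subseteq> {\<one>}" using card_mono[of "{\<one>}" "carrier G - ?M"] by auto
  then obtain z where z: "z \<in> carrier G - ?M" "z \<noteq> \<one>" by blast
  have "g \<otimes> z = z \<otimes> g" if g: "g \<in> carrier G" for g
  proof -
    have "g \<otimes> z \<otimes> inv g = z" using z g by blast
    hence eq: "g \<otimes> z \<otimes> inv g \<otimes> g = z \<otimes> g" by simp
    have "z \<in> carrier G" using z by blast
    thus ?thesis using eq g by (simp add: m_assoc)
  qed
  thus ?thesis using that z by blast
qed

text \<open>Subgroups of \<open>p\<close>-power order whose index is prime to \<open>p\<close>; in this form the notion passes
  to normal subgroups and quotients by comparing orders only.\<close>

definition sylow_in :: "('a, 'b) monoid_scheme \<Rightarrow> nat \<Rightarrow> 'a set \<Rightarrow> bool" where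
  "sylow_in G p P \<longleftrightarrow> subgroup P G \<and> (\<exists>k i. card P = p ^ k \<and> Coset.order G = card P * i \<and> \<not> p dvd i)"

text \<open>\<open>P\<close> acts on the right cosets of \<open>Q\<close>, whose number is prime to
  \<open>p\<close>, so some coset \<open>Q #> x\<close> is fixed. Fixing it means that conjugation
  by \<open>x\<close> carries \<open>P\<close> into \<open>Q\<close>.\<close>

lemma (in group) p_subgroup_conjugate_into_sylow:
  assumes fin: "finite (carrier G)" and p: "Factorial_Ring.prime p"
    and P: "subgroup P G" "card P = p ^ k" and Q: "sylow_in G p Q"
  obtains x where "x \<in> carrier G" "\<And>g. g \<in> P \<Longrightarrow> x \<otimes> g \<otimes> inv x \<in> Q"
proof -
  interpret P: group "G\<lparr>carrier := P\<rparr>" using P(1) by (rule subgroup_imp_group)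
  have Pc: "g \<in> carrier G" if "g \<in> P" for g using subgroup.subset[OF P(1)] that by blast
  have Qs: "subgroup Q G" using Q by (simp add: sylow_in_def)
  have Qc: "Q \<subseteq> carrier G" using subgroup.subset[OF Qs] .
  obtain i where i: "Coset.order G = card Q * i" "\<not> p dvd i" using Q by (auto simp: sylow_in_def)
  let ?E = "rcosets Q"
  have "card Q > 0" using fin Qc subgroup.one_closed[OF Qs] by (metis card_gt_0_iff empty_iff finite_subset)
  hence cardE: "card ?E = i" using lagrange[OF Qs] i(1) by simp
  have rc: "C \<subseteq> carrier G" if "C \<in> ?E" for C using that subgroup.rcosets_carrier[OF Qs is_group] by blast
  \<comment> \<open>The inverse turns right multiplication of cosets into a left action.\<close>
  have "p dvd card {C \<in> ?E. \<exists>g\<in>carrier (G\<lparr>carrier := P\<rparr>). C #> inv g \<noteq> C}"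
  proof (rule P.p_group_dvd_card_nonfixed[OF _ p])
    show "Coset.order (G\<lparr>carrier := P\<rparr>) = p ^ k" using P(2) by (simp add: Coset.order_def)
    show "finite ?E" using fin by (simp add: RCOSETS_def)
    show "C #> inv g \<in> ?E" if g: "g \<in> carrier (G\<lparr>carrier := P\<rparr>)" and C: "C \<in> ?E" for g C
    proof -
      obtain a where a: "a \<in> carrier G" "C = Q #> a" using C by (auto simp: RCOSETS_def)
      have "C #> inv g = Q #> (a \<otimes> inv g)" using a Qc g Pc by (simp add: coset_mult_assoc)
      thus ?thesis using a g Pc by (auto simp: RCOSETS_def)
    qed
    show "C #> inv \<one>\<^bsub>G\<lparr>carrier := P\<rparr>\<^esub> = C" if "C \<in> ?E" for C using rc[OF that] by simp
    show "C #> inv (g \<otimes>\<^bsub>G\<lparr>carrier := P\<rparr>\<^esub> h) = C #> inv h #> inv g"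
      if "g \<in> carrier (G\<lparr>carrier := P\<rparr>)" "h \<in> carrier (G\<lparr>carrier := P\<rparr>)" "C \<in> ?E" for g h C
      using that rc[OF that(3)] Pc by (simp add: inv_mult_group coset_mult_assoc)
  qed
  hence "{C \<in> ?E. \<exists>g\<in>P. C #> inv g \<noteq> C} \<noteq> ?E" using cardE i(2) by auto
  then obtain C where C: "C \<in> ?E" "\<And>g. g \<in> P \<Longrightarrow> C #> inv g = C" by blast
  then obtain x where x: "x \<in> carrier G" "C = Q #> x" by (auto simp: RCOSETS_def)
  have "x \<otimes> g \<otimes> inv x \<in> Q" if g: "g \<in> P" for g
  proof -
    have gi: "inv g \<in> P" using subgroup.m_inv_closed[OF P(1) g] .
    have "Q #> (x \<otimes> g) = C #> inv (inv g)" using x Qc Pc[OF g] by (simp add: coset_mult_assoc)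
    hence "Q #> (x \<otimes> g) = Q #> x" using C(2)[OF gi] x by simp
    hence "x \<otimes> g \<in> Q #> x" using rcos_self[of "x \<otimes> g" Q] x Pc[OF g] Qs by simp
    then obtain h where h: "h \<in> Q" "x \<otimes> g = h \<otimes> x" by (auto simp: r_coset_def)
    have "x \<otimes> g \<otimes> inv x = h" unfolding h(2) using h(1) Qc x by (auto simp: m_assoc)
    thus ?thesis using h by simp
  qed
  thus ?thesis using that x by blast
qed

section \<open>Passage to homomorphic images and kernels\<close>

lemma (in group) card_subgroup_dvd:
  assumes "subgroup A G" "subgroup B G" "A \<subseteq> B"
  shows "card A dvd card B"
proof -
  have "subgroup A (G\<lparr>carrier := B\<rparr>)" using assms by (rule subgroup_incl)
  hence "card (rcosets\<^bsub>G\<lparr>carrier := B\<rparr>\<^esub> A) * card A = card B"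
    using group.lagrange[OF subgroup_imp_group[OF assms(2)]] by (simp add: Coset.order_def)
  thus ?thesis by (metis dvd_triv_right)
qed

text \<open>Orbit-stabilizer for the action of \<open>G\<close> on \<open>H\<close> by left
  multiplication through \<open>h\<close>: the orbit of the identity is the image, its stabilizer
  the kernel.\<close>

lemma (in group_hom) card_image_mult_kernel:
  "card (h ` carrier G) * card (kernel G H h) = Coset.order G"
proof -
  let ?\<phi> = "\<lambda>g. restrict (\<lambda>y. h g \<otimes>\<^bsub>H\<^esub> y) (carrier H)"
  interpret group_action G "carrier H" ?\<phi>
    by (rule G.group_actionI) (auto simp: H.m_assoc)
  have "orbit G ?\<phi> \<one>\<^bsub>H\<^esub> = h ` carrier G" by (force simp: orbit_def)
  moreover have "stabilizer G ?\<phi> \<one>\<^bsub>H\<^esub> = kernel G H h" by (auto simp: stabilizer_def kernel_def)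
  ultimately show ?thesis using orbit_stabilizer_theorem[of "\<one>\<^bsub>H\<^esub>"] by simp
qed

lemma (in group_hom) sylow_in_image_and_kernel:
  assumes fin: "finite (carrier G)" and surj: "h ` carrier G = carrier H"
    and p: "Factorial_Ring.prime p" and P: "sylow_in G p P"
  shows "sylow_in H p (h ` P)" "sylow_in (G\<lparr>carrier := kernel G H h\<rparr>) p (P \<inter> kernel G H h)"
proof -
  let ?N = "kernel G H h"
  have Ps: "subgroup P G" using P by (simp add: sylow_in_def)
  have Pc: "P \<subseteq> carrier G" using subgroup.subset[OF Ps] .
  obtain k i where ki: "card P = p ^ k" "Coset.order G = card P * i" "\<not> p dvd i"
    using P unfolding sylow_in_def by blast
  have N: "subgroup ?N G" by (rule subgroup_kernel)
  have PN: "subgroup (P \<inter> ?N) G" using Ps N by (rule G.subgroups_Inter_pair)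
  have hP: "subgroup (h ` P) H" using Ps by (rule subgroup_img_is_subgroup)
  interpret hP: group_hom "G\<lparr>carrier := P\<rparr>" H h
    using Ps by (rule induced_group_hom')
  have "kernel (G\<lparr>carrier := P\<rparr>) H h = P \<inter> ?N" using Pc by (auto simp: kernel_def)
  hence 1: "card (h ` P) * card (P \<inter> ?N) = card P"
    using hP.card_image_mult_kernel by (simp add: Coset.order_def)
  have 2: "Coset.order H * card ?N = Coset.order G"
    using card_image_mult_kernel surj by (simp add: Coset.order_def)
  have "card (h ` P) dvd Coset.order H"
    using H.lagrange[OF hP] by (metis dvd_triv_right)
  then obtain s where s: "Coset.order H = card (h ` P) * s" by (elim dvdE)
  have "card (P \<inter> ?N) dvd card ?N" using G.card_subgroup_dvd[OF PN N] by simp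
  then obtain t where t: "card ?N = card (P \<inter> ?N) * t" by (elim dvdE)
  have "card P > 0" using ki(1) prime_gt_0_nat[OF p] by simp
  moreover have "card P * (s * t) = card P * i"
    using 1 2 ki(2) unfolding s t by (metis (no_types, lifting) mult.assoc mult.left_commute)
  ultimately have "i = s * t" by simp
  hence st: "\<not> p dvd s" "\<not> p dvd t" using ki(3) by auto
  have d: "card (h ` P) dvd p ^ k" "card (P \<inter> ?N) dvd p ^ k" using 1 ki(1) by (metis dvd_triv_left, metis dvd_triv_right)
  obtain a where a: "card (h ` P) = p ^ a" using d(1) divides_primepow_nat[OF p] by blast
  obtain b where b: "card (P \<inter> ?N) = p ^ b" using d(2) divides_primepow_nat[OF p] by blast
  show "sylow_in H p (h ` P)" unfolding sylow_in_def using hP a s st(1) by blast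
  show "sylow_in (G\<lparr>carrier := ?N\<rparr>) p (P \<inter> ?N)"
    unfolding sylow_in_def using G.subgroup_incl[OF PN N] b t st(2) by (auto simp: Coset.order_def)
qed

text \<open>The two subgroups may depend on the pair of primes; different choices for the same prime
  are compared later by \<open>p_subgroup_conjugate_into_sylow\<close>.\<close>

definition odd_sylows_commute :: "('a, 'b) monoid_scheme \<Rightarrow> bool" where
  "odd_sylows_commute G \<longleftrightarrow> (\<forall>p q. Factorial_Ring.prime p \<longrightarrow> Factorial_Ring.prime q \<longrightarrow> odd p \<longrightarrow> odd q \<longrightarrow> p \<noteq> q \<longrightarrow>
     (\<exists>P Q. sylow_in G p P \<and> sylow_in G q Q \<and> (\<forall>x\<in>P. \<forall>y\<in>Q. x \<otimes>\<^bsub>G\<^esub> y = y \<otimes>\<^bsub>G\<^esub> x)))"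

lemma (in group_hom) odd_sylows_commute_image_and_kernel:
  assumes fin: "finite (carrier G)" and surj: "h ` carrier G = carrier H" and C: "odd_sylows_commute G"
  shows "odd_sylows_commute H" "odd_sylows_commute (G\<lparr>carrier := kernel G H h\<rparr>)"
proof -
  show "odd_sylows_commute H"
    unfolding odd_sylows_commute_def
  proof (intro allI impI)
    fix p q :: nat assume pq: "Factorial_Ring.prime p" "Factorial_Ring.prime q" "odd p" "odd q" "p \<noteq> q"
    then obtain P Q where PQ: "sylow_in G p P" "sylow_in G q Q" "\<forall>x\<in>P. \<forall>y\<in>Q. x \<otimes> y = y \<otimes> x"
      using C unfolding odd_sylows_commute_def by blast
    have sub: "P \<subseteq> carrier G" "Q \<subseteq> carrier G"
      using PQ subgroup.subset unfolding sylow_in_def by blast+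
    have "h x \<otimes>\<^bsub>H\<^esub> h y = h y \<otimes>\<^bsub>H\<^esub> h x" if "x \<in> P" "y \<in> Q" for x y
    proof -
      have xy: "x \<in> carrier G" "y \<in> carrier G" using that sub by auto
      have "x \<otimes> y = y \<otimes> x" using PQ(3) that by blast
      hence "h (x \<otimes> y) = h (y \<otimes> x)" by (rule arg_cong)
      thus ?thesis using xy by simp
    qed
    hence "\<forall>x\<in>h ` P. \<forall>y\<in>h ` Q. x \<otimes>\<^bsub>H\<^esub> y = y \<otimes>\<^bsub>H\<^esub> x" by blast
    thus "\<exists>P Q. sylow_in H p P \<and> sylow_in H q Q \<and> (\<forall>x\<in>P. \<forall>y\<in>Q. x \<otimes>\<^bsub>H\<^esub> y = y \<otimes>\<^bsub>H\<^esub> x)"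
      using sylow_in_image_and_kernel(1)[OF fin surj] pq PQ by blast
  qed
  show "odd_sylows_commute (G\<lparr>carrier := kernel G H h\<rparr>)"
    unfolding odd_sylows_commute_def
  proof (intro allI impI)
    fix p q :: nat assume pq: "Factorial_Ring.prime p" "Factorial_Ring.prime q" "odd p" "odd q" "p \<noteq> q"
    then obtain P Q where PQ: "sylow_in G p P" "sylow_in G q Q" "\<forall>x\<in>P. \<forall>y\<in>Q. x \<otimes> y = y \<otimes> x"
      using C unfolding odd_sylows_commute_def by blast
    let ?N = "G\<lparr>carrier := kernel G H h\<rparr>"
    have mult_eq: "monoid.mult ?N = monoid.mult G" by simp
    have "\<forall>x\<in>P \<inter> kernel G H h. \<forall>y\<in>Q \<inter> kernel G H h. x \<otimes>\<^bsub>?N\<^esub> y = y \<otimes>\<^bsub>?N\<^esub> x"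
      unfolding mult_eq using PQ(3) by blast
    thus "\<exists>P Q. sylow_in ?N p P \<and> sylow_in ?N q Q \<and> (\<forall>x\<in>P. \<forall>y\<in>Q. x \<otimes>\<^bsub>?N\<^esub> y = y \<otimes>\<^bsub>?N\<^esub> x)"
      using sylow_in_image_and_kernel(2)[OF fin surj] pq PQ by blast
  qed
qed

section \<open>A conjugacy class of 2-power size\<close>

lemma power_of_prime_if_unique_prime_divisor:
  fixes n :: nat
  assumes "n > 0" "\<And>q. Factorial_Ring.prime q \<Longrightarrow> q dvd n \<Longrightarrow> q = p"
  shows "\<exists>k. n = p ^ k"
  using assms
proof (induction n rule: less_induct)
  case (less n)
  show ?case
  proof (cases "n = 1")
    case True
    thus ?thesis by (intro exI[of _ 0]) simp
  next
    case False
    then obtain q where q: "Factorial_Ring.prime q" "q dvd n" using prime_factor_nat by blast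
    hence qp: "q = p" using less.prems by blast
    obtain m where m: "n = q * m" using q(2) by (elim dvdE)
    have "m > 0" "m < n" using m less.prems(1) prime_gt_1_nat[OF q(1)] by auto
    moreover have "q' = p" if "Factorial_Ring.prime q'" "q' dvd m" for q'
      using less.prems(2)[OF that(1)] that(2) m by auto
    ultimately obtain k where "m = p ^ k" using less.IH by blast
    thus ?thesis using m qp by (intro exI[of _ "Suc k"]) simp
  qed
qed

lemma (in group) conj_class_eq:
  assumes "g \<in> carrier G" "x \<in> carrier G"
  shows "conj_class (x \<otimes> g \<otimes> inv x) = conj_class g"
proof
  let ?g = "x \<otimes> g \<otimes> inv x"
  have g': "?g \<in> carrier G" "?g \<in> conj_class g" using assms by (auto simp: conj_class_def)
  show "conj_class ?g \<subseteq> conj_class g"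
    using conj_class_conj[OF assms(1) g'(2)] by (auto simp: conj_class_def[of ?g])
  have "inv x \<otimes> ?g \<otimes> inv (inv x) = g" using assms by (simp add: m_assoc inv_mult_cancel)
  hence g_in: "g \<in> conj_class ?g" using assms(2) unfolding conj_class_def by (metis (no_types, lifting) imageI inv_closed)
  show "conj_class g \<subseteq> conj_class ?g"
    using conj_class_conj[OF g'(1) g_in] by (auto simp: conj_class_def[of g])
qed

text \<open>\<open>Q\<close> lies in the centralizer of \<open>z\<close>, so the class size divides
  the index of \<open>Q\<close>.\<close>

lemma (in group) prime_not_dvd_card_conj_class:
  assumes fin: "finite (carrier G)" and q: "Factorial_Ring.prime q" and Q: "sylow_in G q Q"
    and z: "z \<in> carrier G" and comm: "\<And>y. y \<in> Q \<Longrightarrow> y \<otimes> z = z \<otimes> y"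
  shows "\<not> q dvd card (conj_class z)"
proof -
  have Qs: "subgroup Q G" using Q by (simp add: sylow_in_def)
  obtain k i where ki: "card Q = q ^ k" "Coset.order G = card Q * i" "\<not> q dvd i"
    using Q unfolding sylow_in_def by blast
  have "Q \<subseteq> centralizer_of z" using comm subgroup.subset[OF Qs] by (auto simp: centralizer_of_def)
  hence "card Q dvd card (centralizer_of z)" by (rule card_subgroup_dvd[OF Qs centralizer_subgroup[OF z]])
  then obtain t where t: "card (centralizer_of z) = card Q * t" by (elim dvdE)
  have "card Q > 0" using ki(1) prime_gt_0_nat[OF q] by simp
  moreover have "card Q * i = card Q * (t * card (conj_class z))"
    using order_eq_centralizer_times_class[OF fin z] ki(2) t by (simp add: mult.assoc)
  ultimately have "i = t * card (conj_class z)" by simp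
  thus ?thesis using ki(3) by auto
qed

text \<open>If an odd prime \<open>p\<close> divides the order, \<open>z\<close> is central in a
  Sylow \<open>p\<close>-subgroup, so \<open>p\<close> does not divide its class size. For any other
  odd prime \<open>q\<close>, a conjugate of \<open>z\<close> centralises some Sylow
  \<open>q\<close>-subgroup, so \<open>q\<close> does not divide it either.\<close>

lemma (in group) ex_class_of_two_power_size:
  assumes fin: "finite (carrier G)" and nontriv: "Coset.order G > 1" and C: "odd_sylows_commute G"
  obtains z a where "z \<in> carrier G" "z \<noteq> \<one>" "card (conj_class z) = 2 ^ a"
proof -
  have class_pos: "card (conj_class z) > 0" if "z \<in> carrier G" for z
    using conj_class_self[OF that] conj_class_subset[OF that] fin
    by (metis card_gt_0_iff empty_iff finite_subset)
  show ?thesis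
  proof (cases "\<exists>p. Factorial_Ring.prime p \<and> odd p \<and> p dvd Coset.order G")
    case False
    have "carrier G \<noteq> {\<one>}" using nontriv by (auto simp: Coset.order_def)
    then obtain z where z: "z \<in> carrier G" "z \<noteq> \<one>" by blast
    have dvd: "card (conj_class z) dvd Coset.order G"
      using order_eq_centralizer_times_class[OF fin z(1)] by simp
    have "q = 2" if q: "Factorial_Ring.prime q" "q dvd card (conj_class z)" for q
    proof -
      have "even q" using False q dvd dvd_trans by blast
      thus ?thesis using primes_dvd_imp_eq[OF two_is_prime_nat q(1)] by simp
    qed
    hence "\<exists>k. card (conj_class z) = 2 ^ k"
      by (intro power_of_prime_if_unique_prime_divisor class_pos z(1)) blast
    thus ?thesis using that z by blast
  next
    case True
    then obtain p where p: "Factorial_Ring.prime p" "odd p" "p dvd Coset.order G" by blast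
    \<comment> \<open>The hypothesis speaks of pairs of primes, so a second odd prime serves to
      extract a Sylow \<open>p\<close>-subgroup from it.\<close>
    have "\<exists>q :: nat. Factorial_Ring.prime q \<and> odd q \<and> q \<noteq> p"
    proof (cases "p = 3")
      case True
      have "Factorial_Ring.prime (5::nat)" by simp
      thus ?thesis using True by (intro exI[of _ 5]) auto
    next
      case False
      have "Factorial_Ring.prime (3::nat)" by simp
      thus ?thesis using False by (intro exI[of _ 3]) auto
    qed
    then obtain P where P: "sylow_in G p P" using C p unfolding odd_sylows_commute_def by metis
    have Ps: "subgroup P G" using P by (simp add: sylow_in_def)
    have Pc: "P \<subseteq> carrier G" using subgroup.subset[OF Ps] .
    obtain k i where ki: "card P = p ^ k" "Coset.order G = card P * i" "\<not> p dvd i"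
      using P unfolding sylow_in_def by blast
    have k: "k > 0" using p(3) ki by (cases k) auto
    interpret P: group "G\<lparr>carrier := P\<rparr>" using Ps by (rule subgroup_imp_group)
    obtain z where z: "z \<in> P" "z \<noteq> \<one>" "\<And>g. g \<in> P \<Longrightarrow> g \<otimes> z = z \<otimes> g"
      using P.p_group_center_nontrivial[OF _ p(1) k] ki(1) by (auto simp: Coset.order_def)
    have zc: "z \<in> carrier G" using z Pc by blast
    have "q = 2" if q: "Factorial_Ring.prime q" "q dvd card (conj_class z)" for q
    proof (rule ccontr)
      assume "q \<noteq> 2"
      hence oq: "odd q" using primes_dvd_imp_eq[OF two_is_prime_nat q(1)] by auto
      show False
      proof (cases "q = p")
        case True
        thus False using prime_not_dvd_card_conj_class[OF fin p(1) P zc z(3)] q(2) by simp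
      next
        case False
        \<comment> \<open>\<open>P'\<close> depends on \<open>q\<close> and may differ from
          \<open>P\<close>. A conjugate of \<open>z\<close> lies in it, and passing to the conjugate
          does not change the class.\<close>
        then obtain P' Q where PQ: "sylow_in G p P'" "sylow_in G q Q" "\<forall>x\<in>P'. \<forall>y\<in>Q. x \<otimes> y = y \<otimes> x"
          using C p q oq unfolding odd_sylows_commute_def by metis
        obtain x where x: "x \<in> carrier G" "\<And>g. g \<in> P \<Longrightarrow> x \<otimes> g \<otimes> inv x \<in> P'"
          using p_subgroup_conjugate_into_sylow[OF fin p(1) Ps ki(1) PQ(1)] by blast
        have "y \<otimes> (x \<otimes> z \<otimes> inv x) = (x \<otimes> z \<otimes> inv x) \<otimes> y" if "y \<in> Q" for y
          using PQ(3) x(2)[OF z(1)] that by metis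
        hence "\<not> q dvd card (conj_class (x \<otimes> z \<otimes> inv x))"
          by (intro prime_not_dvd_card_conj_class[OF fin q(1) PQ(2)]) (use x zc in auto)
        thus False using q(2) conj_class_eq[OF zc x(1)] by simp
      qed
    qed
    hence "\<exists>k. card (conj_class z) = 2 ^ k"
      by (intro power_of_prime_if_unique_prime_divisor class_pos zc) blast
    thus ?thesis using that zc z by auto
  qed
qed

text \<open>Burnside's theorem leaves only one element in the class of 2-power size, so the center
  is nontrivial; being normal, it is the whole simple group.\<close>

lemma simple_group_odd_sylows_commute_abelian:
  assumes simple: "simple_group G" and fin: "finite (carrier G)" and C: "odd_sylows_commute G"
  shows "comm_group G"
proof -
  interpret simple_group G by (rule simple)
  obtain z a where z: "z \<in> carrier G" "z \<noteq> \<one>\<^bsub>G\<^esub>" "card (conj_class z) = 2 ^ a"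
    using ex_class_of_two_power_size[OF fin order_gt_one C] by blast
  interpret finite_group_class G z using fin z by unfold_locales auto
  have "\<not> card (conj_class z) > 1"
    using simple_group_class_not_prime_power[OF simple two_is_prime_nat z(3)] by blast
  hence "card (conj_class z) \<le> 1" by simp
  hence one: "conj_class z = {z}"
    using conj_class_self[OF z(1)] card_le_Suc0_iff_eq[OF K(2)] by auto
  define Z where "Z = {x \<in> carrier G. \<forall>y\<in>carrier G. x \<otimes>\<^bsub>G\<^esub> y = y \<otimes>\<^bsub>G\<^esub> x}"
  have zZ: "z \<in> Z"
  proof -
    have "y \<otimes>\<^bsub>G\<^esub> z = z \<otimes>\<^bsub>G\<^esub> y" if y: "y \<in> carrier G" for y
    proof -
      have "y \<otimes>\<^bsub>G\<^esub> z \<otimes>\<^bsub>G\<^esub> inv\<^bsub>G\<^esub> y = z" using one y unfolding conj_class_def by blast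
      hence "y \<otimes>\<^bsub>G\<^esub> z \<otimes>\<^bsub>G\<^esub> inv\<^bsub>G\<^esub> y \<otimes>\<^bsub>G\<^esub> y = z \<otimes>\<^bsub>G\<^esub> y" by simp
      thus ?thesis using y z(1) by (simp add: m_assoc)
    qed
    thus ?thesis using z(1) by (simp add: Z_def)
  qed
  have "Z = (\<Inter>y\<in>carrier G. centralizer_of y)"
    by (auto simp: Z_def centralizer_of_def)
  hence Zs: "subgroup Z G"
    using subgroups_Inter[of "centralizer_of ` carrier G"] centralizer_subgroup one_closed by auto
  have "Z \<lhd> G"
  proof (rule normal_invI[OF Zs])
    fix x h assume x: "x \<in> carrier G" and h: "h \<in> Z"
    have "x \<otimes>\<^bsub>G\<^esub> h \<otimes>\<^bsub>G\<^esub> inv\<^bsub>G\<^esub> x = h \<otimes>\<^bsub>G\<^esub> x \<otimes>\<^bsub>G\<^esub> inv\<^bsub>G\<^esub> x" using h x by (simp add: Z_def)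
    also have "\<dots> = h" using h x by (simp add: Z_def m_assoc inv_mult_cancel)
    finally show "x \<otimes>\<^bsub>G\<^esub> h \<otimes>\<^bsub>G\<^esub> inv\<^bsub>G\<^esub> x \<in> Z" using h by simp
  qed
  hence "Z = carrier G" using no_real_normal_subgroup zZ z(2) by blast
  thus ?thesis by (intro group_comm_groupI) (auto simp: Z_def)
qed

section \<open>Reduction to simple groups\<close>

text \<open>A normal subgroup of the quotient pulls back, as the union of its cosets, to a normal
  subgroup of \<open>G\<close> containing \<open>N\<close>; by the choice of \<open>N\<close> as
  largest in cardinality it is \<open>N\<close> or the whole group.\<close>

lemma (in group) FactGroup_simple_if_maximal:
  assumes fin: "finite (carrier G)" and N: "N \<lhd> G" "N \<noteq> carrier G"
    and max: "\<And>A. A \<lhd> G \<Longrightarrow> A \<noteq> carrier G \<Longrightarrow> card A \<le> card N"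
  shows "simple_group (G Mod N)"
proof -
  interpret N: normal N G by (rule N(1))
  interpret Q: group "G Mod N" by (rule N.factorgroup_is_group)
  have finQ: "finite (carrier (G Mod N))" using fin by (simp add: carrier_FactGroup)
  show ?thesis
  proof (unfold_locales)
    have "Coset.order (G Mod N) \<noteq> 1"
      using Q.order_one_triv_iff N.fact_group_trivial_iff[OF fin] N(2) by auto
    moreover have "Coset.order (G Mod N) > 0" using finQ Q.order_gt_0_iff_finite by simp
    ultimately show "1 < Coset.order (G Mod N)" by simp
  next
    fix A assume A: "A \<lhd> G Mod N"
    have As: "subgroup A (G Mod N)" using A by (rule normal_imp_subgroup)
    have U: "\<Union>A \<lhd> G" by (rule N.factgroup_subgroup_union_normal[OF A])
    have U_eq: "\<Union>A = {x \<in> carrier G. N #> x \<in> A}" by (rule N.factgroup_subgroup_union_char[OF As])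
    have NA: "N \<in> A" using subgroup.one_closed[OF As] by simp
    hence NU: "N \<subseteq> \<Union>A" by blast
    show "A = carrier (G Mod N) \<or> A = {\<one>\<^bsub>G Mod N\<^esub>}"
    proof (cases "\<Union>A = carrier G")
      case True
      hence "carrier (G Mod N) \<subseteq> A" unfolding carrier_FactGroup using U_eq by blast
      thus ?thesis using subgroup.subset[OF As] by blast
    next
      case False
      have "\<Union>A \<subseteq> carrier G" using U_eq by blast
      hence "\<Union>A = N" using max[OF U False] NU fin by (metis card_seteq finite_subset)
      have "C = N" if C: "C \<in> A" for C
      proof -
        obtain x where x: "x \<in> carrier G" "C = N #> x"
          using subgroup.subset[OF As] C unfolding carrier_FactGroup by blast
        have "x \<in> C" using x N.subgroup_axioms rcos_self by blast
        hence "x \<in> N" using C \<open>\<Union>A = N\<close> by blast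
        thus ?thesis using x N.subgroup_axioms coset_join2 by blast
      qed
      hence "A = {N}" using NA by blast
      thus ?thesis by simp
    qed
  qed
qed

text \<open>Induction on the order along a proper normal subgroup \<open>N\<close> of largest order.
  As kernel and image of the projection, \<open>N\<close> and the simple quotient inherit the
  property; \<open>N\<close> is solvable by induction and the quotient is abelian.\<close>

theorem solvable_if_odd_sylows_commute:
  fixes G :: "('a, 'b) monoid_scheme"
  assumes "group G" "finite (carrier G)" "odd_sylows_commute G"
  shows "solvable G"
  using assms
proof (induction "Coset.order G" arbitrary: G rule: less_induct)
  case less
  interpret group G by (rule less.prems(1))
  note fin = less.prems(2)
  show ?case
  proof (cases "carrier G = {\<one>\<^bsub>G\<^esub>}")
    case True
    thus ?thesis unfolding solvable_def by (metis solvable_seq.unity)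
  next
    case False
    let ?S = "{N. N \<lhd> G \<and> N \<noteq> carrier G}"
    have "?S \<subseteq> Pow (carrier G)" using normal_imp_subgroup subgroup.subset by blast
    hence "finite ?S" using fin by (meson finite_Pow_iff finite_subset)
    moreover have "{\<one>\<^bsub>G\<^esub>} \<in> ?S" using one_is_normal False by auto
    ultimately have "Max (card ` ?S) \<in> card ` ?S" and max: "\<And>A. A \<in> ?S \<Longrightarrow> card A \<le> Max (card ` ?S)"
      by (auto intro: Max_in)
    then obtain N where N: "N \<in> ?S" "Max (card ` ?S) = card N" by blast
    hence max: "card A \<le> card N" if "A \<in> ?S" for A using max[OF that] by simp
    have simple: "simple_group (G Mod N)"
      by (rule FactGroup_simple_if_maximal[OF fin]) (use N(1) max in auto)
    interpret N: normal N G using N by simp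
    have hom: "group_hom G (G Mod N) (\<lambda>x. N #>\<^bsub>G\<^esub> x)"
      unfolding group_hom_def group_hom_axioms_def
      using N.r_coset_hom_Mod N.factorgroup_is_group is_group by blast
    interpret q: group_hom G "G Mod N" "\<lambda>x. N #>\<^bsub>G\<^esub> x" by (rule hom)
    have surj: "(\<lambda>x. N #>\<^bsub>G\<^esub> x) ` carrier G = carrier (G Mod N)" by (simp add: carrier_FactGroup)
    have ker: "kernel G (G Mod N) (\<lambda>x. N #>\<^bsub>G\<^esub> x) = N"
      using N.subset coset_join1[OF _ _ N.subgroup_axioms] coset_join2[OF _ N.subgroup_axioms]
      by (auto simp: kernel_def)
    note inherit = q.odd_sylows_commute_image_and_kernel[OF fin surj less.prems(3), unfolded ker]
    have "card N < Coset.order G"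
      unfolding Coset.order_def using N(1) N.subset fin by (intro psubset_card_mono) auto
    hence "solvable (G\<lparr>carrier := N\<rparr>)"
      using less.hyps[of "G\<lparr>carrier := N\<rparr>"] subgroup_imp_group[OF N.subgroup_axioms] inherit(2)
        finite_subset[OF N.subset fin] by (simp add: Coset.order_def)
    hence "solvable_seq (G\<lparr>carrier := N\<rparr>) N" by (simp add: solvable_def)
    \<comment> \<open>\<open>solvable_seq\<close> refers to the surrounding group, so the series of
      \<open>N\<close> is carried over to \<open>G\<close> along the inclusion.\<close>
    moreover have "group_hom (G\<lparr>carrier := N\<rparr>) G id"
      unfolding group_hom_def group_hom_axioms_def hom_def
      using subgroup_imp_group[OF N.subgroup_axioms] is_group N.subset by auto
    ultimately have seq: "solvable_seq G (id ` N)" by (rule group_hom.solvable_imp_solvable_img[rotated])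
    have "comm_group (G Mod N)"
      using simple_group_odd_sylows_commute_abelian[OF simple _ inherit(1)] fin by (simp add: carrier_FactGroup)
    hence "solvable_seq G (carrier G)"
      using solvable_seq.extension[of G N "carrier G"] seq N.normal_axioms subgroup_self by simp
    thus ?thesis by (simp add: solvable_def)
  qed
qed

section \<open>Commuting probabilities\<close>

text \<open>The index is a divisor of \<open>p ^ k\<close> other than 1, hence at least
  \<open>p\<close>.\<close>

lemma (in group) proper_subgroup_card_le:
  assumes A: "subgroup A G" and B: "subgroup B G" "card B = p ^ k" and AB: "A \<subset> B"
    and p: "Factorial_Ring.prime (p :: nat)"
  shows "p * card A \<le> card B"
proof -
  have B0: "card B > 0" using B(2) prime_gt_0_nat[OF p] by simp
  hence finB: "finite B" by (rule card_ge_0_finite)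
  have "card A dvd card B" using card_subgroup_dvd[OF A B(1)] AB by blast
  then obtain t where t: "card B = card A * t" by (elim dvdE)
  have "t dvd p ^ k" using t B(2) by (metis dvd_triv_right)
  then obtain i where i: "t = p ^ i" using divides_primepow_nat[OF p] by blast
  have "t \<noteq> 1" using psubset_card_mono[OF finB AB] t by auto
  hence "p \<le> t" using i prime_gt_1_nat[OF p] by (cases i) (auto simp: self_le_power)
  thus ?thesis using t by (simp add: mult.commute)
qed

text \<open>The elements of \<open>P\<close> that centralise \<open>Q\<close> form a proper
  subgroup, at most a fraction \<open>1 / p\<close> of \<open>P\<close>. Every other element of
  \<open>P\<close> commutes with at most a fraction \<open>1 / q\<close> of
  \<open>Q\<close>.\<close>

lemma (in group) comm_prob_noncommuting_le:
  fixes p q :: nat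
  assumes P: "subgroup P G" "card P = p ^ k" and Q: "subgroup Q G" "card Q = q ^ l"
    and p: "Factorial_Ring.prime p" and q: "Factorial_Ring.prime q"
    and nc: "\<not> (\<forall>x\<in>P. \<forall>y\<in>Q. x \<otimes> y = y \<otimes> x)"
  shows "comm_prob G P Q \<le> 1 - (1 - 1 / p) * (1 - 1 / q)"
proof -
  have P0: "card P > 0" and Q0: "card Q > 0"
    using P Q prime_gt_0_nat p q by auto
  have finP: "finite P" and finQ: "finite Q" using P0 Q0 by (auto intro: card_ge_0_finite)
  have Pc: "P \<subseteq> carrier G" and Qc: "Q \<subseteq> carrier G" using P Q subgroup.subset by auto
  define Z where "Z = {x \<in> P. \<forall>y\<in>Q. x \<otimes> y = y \<otimes> x}"
  have "Z = P \<inter> (\<Inter>y\<in>Q. centralizer_of y)"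
    using Pc by (auto simp: Z_def centralizer_of_def)
  moreover have "subgroup (\<Inter>y\<in>Q. centralizer_of y) G"
    using subgroups_Inter[of "centralizer_of ` Q"] centralizer_subgroup Qc subgroup.one_closed[OF Q(1)] by auto
  ultimately have Z: "subgroup Z G" using subgroups_Inter_pair[OF P(1)] by simp
  have "Z \<subset> P" using nc by (auto simp: Z_def)
  hence cPZ: "real (card (P - Z)) = real (card P) - real (card Z)"
    using finP by (simp add: card_Diff_subset finite_subset[of Z P] card_mono of_nat_diff psubset_imp_subset)
  have Zle: "p * card Z \<le> card P" using proper_subgroup_card_le[OF Z P \<open>Z \<subset> P\<close> p] .
  have Cle: "q * card {y \<in> Q. x \<otimes> y = y \<otimes> x} \<le> card Q" if x: "x \<in> P - Z" for x
  proof -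
    have "{y \<in> Q. x \<otimes> y = y \<otimes> x} = Q \<inter> centralizer_of x"
      using Qc by (auto simp: centralizer_of_def)
    moreover have "x \<in> carrier G" using x Pc by blast
    ultimately have "subgroup {y \<in> Q. x \<otimes> y = y \<otimes> x} G"
      using subgroups_Inter_pair[OF Q(1) centralizer_subgroup] by simp
    moreover have "{y \<in> Q. x \<otimes> y = y \<otimes> x} \<subset> Q" using x by (auto simp: Z_def)
    ultimately show ?thesis using proper_subgroup_card_le[OF _ Q _ q] by blast
  qed
  have p1: "real p > 1" and q1: "real q > 1" using prime_gt_1_nat p q by auto
  have "{(x, y). x \<in> P \<and> y \<in> Q \<and> x \<otimes> y = y \<otimes> x} = Sigma P (\<lambda>x. {y \<in> Q. x \<otimes> y = y \<otimes> x})" by auto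
  hence "card {(x, y). x \<in> P \<and> y \<in> Q \<and> x \<otimes> y = y \<otimes> x} = (\<Sum>x\<in>P. card {y \<in> Q. x \<otimes> y = y \<otimes> x})"
    using finP finQ by (simp add: card_SigmaI)
  hence "real (card {(x, y). x \<in> P \<and> y \<in> Q \<and> x \<otimes> y = y \<otimes> x})
      = (\<Sum>x\<in>P. real (card {y \<in> Q. x \<otimes> y = y \<otimes> x}))" by simp
  also have "\<dots> \<le> (\<Sum>x\<in>P. if x \<in> Z then real (card Q) else card Q / q)"
  proof (rule sum_mono)
    fix x assume x: "x \<in> P"
    show "real (card {y \<in> Q. x \<otimes> y = y \<otimes> x}) \<le> (if x \<in> Z then real (card Q) else card Q / q)"
    proof (cases "x \<in> Z")
      case True
      thus ?thesis using finQ by (auto intro: card_mono)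
    next
      case False
      hence "q * card {y \<in> Q. x \<otimes> y = y \<otimes> x} \<le> card Q" using Cle x by blast
      hence "real (q * card {y \<in> Q. x \<otimes> y = y \<otimes> x}) \<le> real (card Q)" by (simp only: of_nat_le_iff)
      thus ?thesis using False q1 by (simp add: field_simps)
    qed
  qed
  also have "\<dots> = card Z * real (card Q) + card (P - Z) * (card Q / q)"
  proof -
    have "P \<inter> {x. x \<in> Z} = Z" "P \<inter> - {x. x \<in> Z} = P - Z" by (auto simp: Z_def)
    thus ?thesis using finP by (simp add: sum.If_cases)
  qed
  \<comment> \<open>Collected in this way, \<open>card Z\<close> has the nonnegative factor
    \<open>1 - 1 / q\<close>, so its upper bound can be inserted.\<close>
  also have "\<dots> = card Q * (card Z * (1 - 1 / q) + card P / q)"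
    by (simp add: cPZ algebra_simps)
  also have "\<dots> \<le> card Q * ((card P / p) * (1 - 1 / q) + card P / q)"
  proof -
    have "real (p * card Z) \<le> real (card P)" using Zle by (simp only: of_nat_le_iff)
    hence "card Z \<le> card P / p" using p1 by (simp add: field_simps)
    thus ?thesis using q1 by (intro mult_left_mono add_right_mono mult_right_mono) auto
  qed
  also have "\<dots> = (1 - (1 - 1 / p) * (1 - 1 / q)) * (real (card P) * real (card Q))"
    using p1 q1 by (simp add: field_simps)
  finally show ?thesis
    unfolding comm_prob_def using P0 Q0 by (simp add: divide_le_eq)
qed

text \<open>One of the primes is at least 3 and the other at least 5; the constant is the value at 3
  and 5, namely 1 - (2/3)(4/5).\<close>

lemma one_minus_odd_primes_le:
  assumes p: "Factorial_Ring.prime p" "p \<noteq> 2" and q: "Factorial_Ring.prime q" "q \<noteq> 2" and pq: "p \<noteq> (q :: nat)"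
  shows "1 - (1 - 1 / p) * (1 - 1 / q) \<le> (7 / 15 :: real)"
proof -
  have *: "(2 / 3) * (4 / 5) \<le> (1 - 1 / real a) * (1 - 1 / real b)" if "a \<ge> 3" "b \<ge> 5" for a b :: nat
  proof (rule mult_mono)
    show "2 / 3 \<le> 1 - 1 / real a" "4 / 5 \<le> 1 - 1 / real b" using that by (auto simp: field_simps)
  qed (use that in auto)
  have ge: "r \<ge> 3" "r = 3 \<or> r \<ge> 5" if r: "Factorial_Ring.prime r" "r \<noteq> 2" for r :: nat
  proof -
    have "odd r" using r primes_dvd_imp_eq[OF two_is_prime_nat r(1)] by auto
    moreover have "r \<ge> 2" using r prime_ge_2_nat by blast
    ultimately show "r \<ge> 3" "r = 3 \<or> r \<ge> 5" by presburger+
  qed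
  have "q \<ge> 5 \<or> p \<ge> 5" using ge[OF p] ge[OF q] pq by auto
  thus ?thesis using *[of p q] *[of q p] ge(1)[OF p] ge(1)[OF q] by (auto simp: mult.commute)
qed

section \<open>The greatest admissible bound\<close>

lemma sylow_subgroup_imp_sylow_in:
  assumes G: "group G" "finite (carrier G)" and p: "Factorial_Ring.prime p" and P: "sylow_subgroup G p P"
  shows "sylow_in G p P"
proof -
  interpret group G by (rule G(1))
  have o: "Coset.order G \<noteq> 0" using G(2) order_gt_0_iff_finite by simp
  then obtain i where "Coset.order G = p ^ multiplicity p (Coset.order G) * i" "\<not> p dvd i"
    using multiplicity_decompose'[of "Coset.order G" p] p by (metis not_prime_unit)
  thus ?thesis using P unfolding sylow_in_def sylow_subgroup_def by auto
qed

lemma ex_sylow_subgroup: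
  assumes G: "group G" "finite (carrier G)" and p: "Factorial_Ring.prime p"
  shows "\<exists>P. sylow_subgroup G p P"
proof -
  have "p ^ multiplicity p (Coset.order G) dvd Coset.order G" by (rule multiplicity_dvd)
  then obtain i where "Coset.order G = p ^ multiplicity p (Coset.order G) * i" by (elim dvdE)
  thus ?thesis using sylow_thm[OF p G(1) _ G(2)] unfolding sylow_subgroup_def by blast
qed

text \<open>The \<open>GREATEST\<close> in \<open>pr_star\<close> ranges over the reals, so the
  existence of a maximum has to be shown. Commuting probabilities of Sylow subgroups lie in the
  finite set \<open>V\<close>; hence any admissible bound can be raised to an admissible element of
  \<open>V\<close>, and the largest of these is the maximum.\<close>

lemma pr_star_attained:
  fixes G :: "('a, 'b) monoid_scheme"
  assumes G: "group G" "finite (carrier G)"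
    and p: "p \<in> primes_except 2" and q: "q \<in> primes_except 2" and pq: "p \<noteq> q"
  shows "\<exists>P Q. sylow_subgroup G p P \<and> sylow_subgroup G q Q
    \<and> comm_prob G P Q \<ge> pr_star G (primes_except 2) (primes_except 2)"
proof -
  define good where "good = (\<lambda>\<epsilon>. \<forall>p\<in>primes_except 2. \<forall>q\<in>primes_except 2. p \<noteq> q \<longrightarrow>
      (\<exists>P Q. sylow_subgroup G p P \<and> sylow_subgroup G q Q \<and> comm_prob G P Q \<ge> \<epsilon>))"
  \<comment> \<open>The value 0 is always admissible; inserting it makes the set of admissible
    elements of \<open>V\<close> nonempty.\<close>
  define V where "V = insert 0 ((\<lambda>(P, Q). comm_prob G P Q) ` (Pow (carrier G) \<times> Pow (carrier G)))"
  have finV: "finite V" using G(2) by (simp add: V_def)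
  have cpV: "comm_prob G P Q \<in> V" if "sylow_subgroup G p P" "sylow_subgroup G q Q" for P Q p q
    using that subgroup.subset unfolding V_def sylow_subgroup_def by fastforce
  have "good 0"
    unfolding good_def primes_except_def comm_prob_def using ex_sylow_subgroup[OF G] by fastforce
  hence W: "finite {v \<in> V. good v}" "{v \<in> V. good v} \<noteq> {}" using finV by (auto simp: V_def)
  define g where "g = Max {v \<in> V. good v}"
  have "good g" using Max_in[OF W] by (simp add: g_def)
  moreover have "y \<le> g" if y: "good y" for y
  proof -
    let ?U = "{v \<in> V. v \<ge> y}"
    \<comment> \<open>The pair 3, 5 supplies at least one commuting probability that is not below
      \<open>y\<close>, whether or not these primes divide the order.\<close>
    have p3: "(3::nat) \<in> primes_except 2" "(5::nat) \<in> primes_except 2" by (auto simp: primes_except_def)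
    obtain P Q where "sylow_subgroup G 3 P" "sylow_subgroup G 5 Q" "comm_prob G P Q \<ge> y"
      using y p3 unfolding good_def by fastforce
    hence "comm_prob G P Q \<in> ?U" using cpV by blast
    hence U: "finite ?U" "?U \<noteq> {}" using finV by auto
    have "good (Min ?U)"
      unfolding good_def
    proof (intro ballI impI)
      fix p q :: nat assume "p \<in> primes_except 2" "q \<in> primes_except 2" "p \<noteq> q"
      then obtain P Q where PQ: "sylow_subgroup G p P" "sylow_subgroup G q Q" "comm_prob G P Q \<ge> y"
        using y unfolding good_def by blast
      hence "Min ?U \<le> comm_prob G P Q" using U cpV by (intro Min_le) auto
      thus "\<exists>P Q. sylow_subgroup G p P \<and> sylow_subgroup G q Q \<and> comm_prob G P Q \<ge> Min ?U" using PQ by blast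
    qed
    moreover have "Min ?U \<in> ?U" using Min_in[OF U] .
    ultimately have "Min ?U \<le> g" unfolding g_def using W(1) by (intro Max_ge) auto
    thus ?thesis using \<open>Min ?U \<in> ?U\<close> by auto
  qed
  ultimately have "(GREATEST \<epsilon>. good \<epsilon>) = g" by (intro Greatest_equality)
  hence "good (pr_star G (primes_except 2) (primes_except 2))"
    using \<open>good g\<close> unfolding pr_star_def good_def[symmetric] by simp
  thus ?thesis using p q pq unfolding good_def by blast
qed

theorem theorem1p4:
  fixes G :: "('a, 'b) monoid_scheme"
  assumes "group G" and "finite (carrier G)"
    and "pr_star G (primes_except 2) (primes_except 2) > 7 / 15"
  shows "solvable G"
proof (rule solvable_if_odd_sylows_commute[OF assms(1,2)])
  interpret group G by (rule assms(1))
  show "odd_sylows_commute G"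
    unfolding odd_sylows_commute_def
  proof (intro allI impI)
    fix p q :: nat
    assume p: "Factorial_Ring.prime p" and q: "Factorial_Ring.prime q" and "odd p" "odd q" and pq: "p \<noteq> q"
    hence ne: "p \<noteq> 2" "q \<noteq> 2" by auto
    obtain P Q where PQ: "sylow_subgroup G p P" "sylow_subgroup G q Q" "comm_prob G P Q > 7 / 15"
      using pr_star_attained[OF assms(1,2), of p q] p q ne pq assms(3)
      unfolding primes_except_def by force
    have "\<forall>x\<in>P. \<forall>y\<in>Q. x \<otimes>\<^bsub>G\<^esub> y = y \<otimes>\<^bsub>G\<^esub> x"
    proof (rule ccontr)
      assume "\<not> ?thesis"
      hence "comm_prob G P Q \<le> 1 - (1 - 1 / p) * (1 - 1 / q)"
        using PQ(1,2) p q unfolding sylow_subgroup_def by (intro comm_prob_noncommuting_le) auto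
      thus False using one_minus_odd_primes_le[OF p ne(1) q ne(2) pq] PQ(3) by linarith
    qed
    thus "\<exists>P Q. sylow_in G p P \<and> sylow_in G q Q \<and> (\<forall>x\<in>P. \<forall>y\<in>Q. x \<otimes>\<^bsub>G\<^esub> y = y \<otimes>\<^bsub>G\<^esub> x)"
      using sylow_subgroup_imp_sylow_in[OF assms(1,2)] PQ p q by blast
  qed
qed

end
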